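(* Let $1/2<\alpha<1$ and let $q\in L^\infty[0,1]$ be real valued. Consider the fractional eigenvalue problem $$-{}^{c}\mathcal{D}_{0^+}^{\alpha}\circ\mathcal{D}_{0^+}^{\alpha}y(t)+q(t)y(t)=\lambda y(t),\quad 0\le t\le 1,\qquad \mathcal{I}_{0^+}^{1-\alpha}y(t)|_{t=0}=0,\quad \mathcal{I}_{0^+}^{1-\alpha}y(t)|_{t=1}=0,$$ with eigenfunctions in $C[0,1]$. Then this problem has only finitely many real eigenvalues, and it has infinitely many non-real eigenvalues.
   Context: For $\beta>0$ the left Riemann-Liouville fractional integral is $\mathcal{I}_{0^+}^{\beta}f(t)=\frac{1}{\Gamma(\beta)}\int_0^t (t-s)^{\beta-1}f(s)\,ds$. For $0<\alpha<1$ the left Riemann-Liouville derivative is $\mathcal{D}_{0^+}^{\alpha}f=\frac{d}{dt}\mathcal{I}_{0^+}^{1-\alpha}f$ and the left Caputo derivative is ${}^{c}\mathcal{D}_{0^+}^{\alpha}f=\mathcal{I}_{0^+}^{1-\alpha}(f')$. Solutions of the differential equation are understood through the equivalent integral equation. A solution $y\in C[0,1]$ of the equation with $\mathcal{I}_{0^+}^{1-\alpha}y|_{t=0}=0$ is a continuous function $y:[0,1]\to\mathbb{C}$ such that, for some constant $c_2\in\mathbb{C}$ (namely $c_2=\mathcal{D}_{0^+}^{\alpha}y|_{t=0}$), $$y(t)=c_2\frac{t^{\alpha}}{\Gamma(\alpha+1)}+\frac{1}{\Gamma(2\alpha)}\int_0^t (t-s)^{2\alpha-1}(q(s)-\lambda)y(s)\,ds,\qquad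 t\in[0,1].$$ A number $\lambda\in\mathbb{C}$ is an eigenvalue if there is such a solution $y\not\equiv 0$ with $\mathcal{I}_{0^+}^{1-\alpha}y(t)|_{t=1}=0$. *)

theory Defs
  imports "HOL-Analysis.Analysis"
begin

definition rl_integral :: "real \<Rightarrow> (real \<Rightarrow> complex) \<Rightarrow> real \<Rightarrow> complex" where
  "rl_integral \<beta> f t =
     (1 / Gamma \<beta>) *\<^sub>R (LINT s:{0..t}|lebesgue. (t - s) powr (\<beta> - 1) *\<^sub>R f s)"

definition L_infinity_01 :: "(real \<Rightarrow> real) \<Rightarrow> bool" where
  "L_infinity_01 q \<longleftrightarrow>
     q \<in> borel_measurable (lebesgue_on {0..1}) \<and>
     (\<exists>C. AE x in lebesgue_on {0..1}. \<bar>q x\<bar> \<le> C)"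

text \<open>
  Continuous solutions on $[0,1]$ of $-{}^{c}D^{\alpha} D^{\alpha} y + q y = \lambda y$ with
  $I^{1-\alpha} y|_{t=0} = 0$, understood through the equivalent integral equation.
  The constant \<open>c\<close> is the value of the Riemann-Liouville derivative $D^{\alpha} y$ at $0$;
  the condition at $t = 0$ is what removes the term $c_1 t^{\alpha-1}/\Gamma(\alpha)$ from the
  general solution. Only the values of \<open>y\<close> on $[0,1]$ matter.
\<close>

definition is_solution :: "real \<Rightarrow> (real \<Rightarrow> real) \<Rightarrow> complex \<Rightarrow> (real \<Rightarrow> complex) \<Rightarrow> bool" where
  "is_solution \<alpha> q \<mu> y \<longleftrightarrow>
     continuous_on {0..1} y \<and>
     (\<exists>c::complex. \<forall>t\<in>{0..1}.
        y t = c * of_real (t powr \<alpha> / Gamma (\<alpha> + 1))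
              + rl_integral (2 * \<alpha>) (\<lambda>s. (of_real (q s) - \<mu>) * y s) t)"

definition is_eigenvalue :: "real \<Rightarrow> (real \<Rightarrow> real) \<Rightarrow> complex \<Rightarrow> bool" where
  "is_eigenvalue \<alpha> q \<mu> \<longleftrightarrow>
     (\<exists>y. is_solution \<alpha> q \<mu> y \<and> (\<exists>t\<in>{0..1}. y t \<noteq> 0) \<and> rl_integral (1 - \<alpha>) y 1 = 0)"

end

theory Submission
  imports Defs "HOL-Complex_Analysis.Complex_Analysis"
begin

text \<open>
  A solution with constant \<open>c\<close> is \<open>c\<close> times the Neumann series \<open>y = \<Sum>n. u n\<close> of the integral equation, so
  the eigenvalues are the zeros of \<open>F \<mu> = I\<^sup>1\<^sup>-\<^sup>\<alpha> y 1\<close>. This is a locally uniform sum of polynomials in \<open>\<mu>\<close>,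
  hence entire, and its growth is at most \<open>exp (O (\<bar>\<mu>\<bar> powr (1 / (2 \<alpha>))))\<close>, of order less than one.

  For \<open>\<mu>\<close> below \<open>- \<parallel>q\<parallel>\<close> all \<open>u n\<close> are nonnegative and \<open>F \<mu> \<ge> 1\<close>. For \<open>\<mu> = l \<rightarrow> \<infinity>\<close> we treat \<open>q\<close> as a
  perturbation of \<open>q = 0\<close>. There the resolvent kernels are Mittag-Leffler functions at negative arguments,
  which are \<open>O (z powr - c)\<close> for every \<open>c < 1\<close> by a Mellin-Barnes representation; this gives
  \<open>l * F l \<rightarrow> 1 / \<Gamma> (2 - 2 \<alpha>) \<noteq> 0\<close>. So the real zeros of \<open>F\<close> are bounded, hence finite in number. If \<open>F\<close>
  had only finitely many zeros at all, then, being of order less than one, it would be a polynomial up to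
  a constant factor and could not tend to \<open>0\<close> along the positive half line.
\<close>

section \<open>The Mittag-Leffler function on the negative half line\<close>

text \<open>For large positive \<open>l\<close> the terms of the Neumann series, already for
  \<open>q = 0\<close>, alternate in sign and reach a size exponential in
  \<open>l powr (1 / (2 * \<alpha>))\<close>. The smallness of \<open>F l\<close> is thus a matter
  of cancellation, and termwise estimates say nothing. All cancellation is put into one scalar
  object, the Mittag-Leffler function with a = 2 \<alpha>, and sums are formed before absolute
  values are taken. The window 1 < a < 2 enters twice: a > 1 gives the order 1 / a < 1, while a < 2
  lets the decay exp (- pi |t|) of pi / sin on a vertical line beat the growth exp (pi a |t| / 2) of
  the reciprocal Gamma function.

  Decay of order c < 1 alone cannot identify a limit of \<open>l * F l\<close>. The leading term
  comes from an index shift, l E_{a,2}(-l) = 1 / Gamma (2 - a) - E_{a,2-a}(-l), where only the last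
  term is estimated. The part containing \<open>q\<close> is a product of two small factors, l powr
  (-3/4) from a kernel and l powr (-1/2) from the solution, and 3/4 + 1/2 > 1.\<close>

lemma norm_sin_squared_cosh:
  "(norm (sin z))\<^sup>2 = (cosh (Im z))\<^sup>2 - (cos (Re z))\<^sup>2"
proof -
  have "exp (2 * Im z) = (exp (Im z))\<^sup>2" and "cos (2 * Re z) = 2 * (cos (Re z))\<^sup>2 - 1"
    by (simp_all add: power2_eq_square cos_double_cos flip: exp_add)
  then show ?thesis
    unfolding norm_sin_squared cosh_field_def
    by (simp only:) (simp add: power2_eq_square exp_minus divide_simps algebra_simps)
qed

lemma norm_sin_ge_cosh: "\<bar>sin (Re z)\<bar> * cosh (Im z) \<le> norm (sin z)"
proof (rule power2_le_imp_le)
  have "(cosh (Im z))\<^sup>2 \<ge> 1" 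
    by (simp add: cosh_square_eq)
  then have "(cos (Re z))\<^sup>2 * 1 \<le> (cos (Re z))\<^sup>2 * (cosh (Im z))\<^sup>2"
    by (intro mult_left_mono) auto
  then show "(\<bar>sin (Re z)\<bar> * cosh (Im z))\<^sup>2 \<le> (norm (sin z))\<^sup>2"
    unfolding norm_sin_squared_cosh power_mult_distrib power2_abs sin_squared_eq
    by (simp add: algebra_simps)
qed auto

text \<open>Meant for horizontal segments, where the real part may pass through zeros of the real
  sine and \<open>norm_sin_ge_cosh\<close> becomes void. This bound does not involve the real
  part.\<close>

lemma norm_sin_ge_sinh: "sinh \<bar>Im z\<bar> \<le> norm (sin z)"
proof (rule power2_le_imp_le)
  have "(cos (Re z))\<^sup>2 \<le> 1" by (simp add: abs_square_le_1)
  then show "(sinh \<bar>Im z\<bar>)\<^sup>2 \<le> (norm (sin z))\<^sup>2"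
    unfolding norm_sin_squared_cosh by (simp add: sinh_square_eq)
qed auto

lemma cosh_ge_half_exp_abs: "exp \<bar>y\<bar> / 2 \<le> cosh (y::real)"
  by (cases "y \<ge> 0") (auto simp: cosh_field_def)

lemma integrable_exp_minus_abs:
  assumes "0 < (k::real)"
  shows "integrable lborel (\<lambda>x. exp (- (k * \<bar>x\<bar>)))"
proof -
  have "(\<lambda>x. exp (- (k * x))) absolutely_integrable_on {0..}"
    using integrable_on_exp_minus_to_infinity[OF assms, of 0]
    by (intro nonnegative_absolutely_integrable_1) auto
  then have I: "integrable lborel (\<lambda>x. indicator {0..} x *\<^sub>R exp (- (k * x)))"
    unfolding set_integrable_def by (subst (asm) integrable_completion) auto
  from lborel_integrable_real_affine[OF this, of "-1" 0]
  have J: "integrable lborel (\<lambda>x. indicator {0..} (-x) *\<^sub>R exp (k * x))" by simp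
  show ?thesis
    by (rule Bochner_Integration.integrable_bound[OF Bochner_Integration.integrable_add[OF I J]])
       (auto simp: indicator_def abs_if)
qed

lemma sin_line_bound:
  assumes "0 < c" "c < 1"
  shows "norm (of_real pi / sin (of_real pi * Complex c t)) \<le> 2 * pi / sin (pi * c) * exp (- (pi * \<bar>t\<bar>))"
proof -
  have s: "sin (pi * c) > 0" 
    using assms by (intro sin_gt_zero) auto
  have "sin (pi * c) * (exp (pi * \<bar>t\<bar>) / 2) \<le> sin (pi * c) * cosh (pi * t)"
    using cosh_ge_half_exp_abs[of "pi * t"] s by (intro mult_left_mono) (auto simp: abs_mult)
  also have "\<dots> \<le> norm (sin (of_real pi * Complex c t))"
    using norm_sin_ge_cosh[of "of_real pi * Complex c t"] s by simp
  finally have le: "sin (pi * c) * (exp (pi * \<bar>t\<bar>) / 2) \<le> norm (sin (of_real pi * Complex c t))" .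
  then have "pi / norm (sin (of_real pi * Complex c t)) \<le> pi / (sin (pi * c) * (exp (pi * \<bar>t\<bar>) / 2))"
    using s by (intro divide_left_mono) (auto intro!: mult_pos_pos less_le_trans[OF _ le])
  then show ?thesis by (simp add: norm_divide exp_minus field_simps)
qed

text \<open>The integral of the majorant on the line, finite because b < pi. It depends only on the
  line and the growth rate, so the constant D of an integrand enters linearly; later D carries the
  powers of z and the decay in k.\<close>

definition sin_line_const :: "real \<Rightarrow> real \<Rightarrow> real" where
  "sin_line_const b c = (LINT t|lborel. 2 * pi / sin (pi * c) * exp (- ((pi - b) * \<bar>t\<bar>)))"

lemma
  fixes h :: "real \<Rightarrow> complex"
  assumes c: "0 < c" "c < 1" and b: "b < pi"
    and h[measurable]: "h \<in> borel_measurable borel" and bound: "\<And>t. norm (h t) \<le> D * exp (b * \<bar>t\<bar>)"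
  shows integrable_sin_line: "integrable lborel (\<lambda>t. h t * (of_real pi / sin (of_real pi * Complex c t)))"
    and integral_sin_line_bound:
      "norm (LINT t|lborel. h t * (of_real pi / sin (of_real pi * Complex c t))) \<le> D * sin_line_const b c"
proof -
  let ?B = "\<lambda>t. 2 * pi / sin (pi * c) * exp (- ((pi - b) * \<bar>t\<bar>))"
  have D: "0 \<le> D" using bound[of 0] norm_ge_zero[of "h 0"] by (simp del: norm_ge_zero)
  have I: "integrable lborel ?B"
    using b by (intro integrable_mult_right integrable_exp_minus_abs) auto
  have le: "norm (h t * (of_real pi / sin (of_real pi * Complex c t))) \<le> D * ?B t" for t
  proof -
    have "norm (h t * (of_real pi / sin (of_real pi * Complex c t)))
      \<le> (D * exp (b * \<bar>t\<bar>)) * (2 * pi / sin (pi * c) * exp (- (pi * \<bar>t\<bar>)))"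
      unfolding norm_mult using bound[of t] sin_line_bound[OF c, of t] D
      by (intro mult_mono) auto
    also have "\<dots> = D * ?B t"
      by (simp add: algebra_simps exp_diff exp_minus divide_simps)
    finally show ?thesis .
  qed
  have m: "(\<lambda>t. of_real pi / sin (of_real pi * Complex c t)) \<in> borel_measurable borel"
    unfolding complex_eq_cancel_iff2 Complex_eq
    by measurable
  note m[measurable]
  show i: "integrable lborel (\<lambda>t. h t * (of_real pi / sin (of_real pi * Complex c t)))"
  proof (rule Bochner_Integration.integrable_bound[OF integrable_mult_right[OF I, of D]])
    show "AE t in lborel. norm (h t * (of_real pi / sin (of_real pi * Complex c t))) \<le> norm (D * ?B t)"
      using order.trans[OF le abs_ge_self] by (intro AE_I2) (simp only: real_norm_def)
  qed measurable
  have "norm (LINT t|lborel. h t * (of_real pi / sin (of_real pi * Complex c t))) \<le> (LINT t|lborel. D * ?B t)"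
    by (rule Bochner_Integration.integral_norm_bound_integral[OF i integrable_mult_right[OF I, of D]]) (use le in auto)
  then show "norm (LINT t|lborel. h t * (of_real pi / sin (of_real pi * Complex c t))) \<le> D * sin_line_const b c"
    unfolding sin_line_const_def by simp
qed

section \<open>Contour integrals against pi / sin (pi z)\<close>

lemma continuous_on_Complex_line: "continuous_on A (\<lambda>t. Complex c t)"
  unfolding Complex_eq by (intro continuous_intros)

lemma measurable_on_line:
  fixes H :: "complex \<Rightarrow> complex"
  assumes "H holomorphic_on UNIV"
  shows "(\<lambda>t. H (Complex c t)) \<in> borel_measurable borel"
  by (intro borel_measurable_continuous_onI continuous_on_compose2[OF holomorphic_on_imp_continuous_on[OF assms]]
        continuous_on_Complex_line) auto

text \<open>Residue theorem for pi H(z) / sin (pi z) on a rectangle of width one whose only pole is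
  0. Since sin (pi (z - 1)) = - sin (pi z), the left side can be written over the sine of the right
  side, and this sign cancels the one from the downward orientation: hence a sum of values of H. The
  error is the contribution of the two horizontal sides, each of length one.\<close>

lemma rectangle_sin:
  fixes H :: "complex \<Rightarrow> complex"
  assumes H: "H holomorphic_on UNIV" and c: "0 < c" "c < 1" and b: "b < pi" "0 \<le> b"
    and bound: "\<And>z. c - 1 \<le> Re z \<Longrightarrow> Re z \<le> c \<Longrightarrow> norm (H z) \<le> D * exp (b * \<bar>Im z\<bar>)"
    and T: "T > 0"
  shows "norm (integral {-T..T} (\<lambda>t. (H (Complex c t) + H (Complex (c - 1) t))
                  * (of_real pi / sin (of_real pi * Complex c t))) - 2 * pi * H 0)
         \<le> 2 * (pi * D * exp (b * T) / sinh (pi * T))"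
proof -
  define f where "f z = (of_real pi * H z) / sin (of_real pi * z)" for z
  define S where "S = {z::complex. -1 < Re z \<and> Re z < 1}"
  have D: "0 \<le> D" using order.trans[OF norm_ge_zero bound[of "of_real c"]] c by simp
  have S: "open S" "convex S"
  proof -
    have "S = {z. Re z > -1} \<inter> {z. Re z < 1}" by (auto simp: S_def)
    then show "open S" "convex S"
      by (auto intro!: open_Int open_halfspace_Re_gt open_halfspace_Re_lt convex_Int
          convex_halfspace_Re_gt convex_halfspace_Re_lt)
  qed
  have sin0: "sin (of_real pi * z) \<noteq> 0" if "z \<in> S" "z \<noteq> 0" for z
  proof
    assume "sin (of_real pi * z) = 0"
    then obtain n::int where "of_real pi * z = of_real (n * pi)"
      by (auto simp: sin_eq_0)
    then have z: "z = of_int n" by simp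
    with that(1) have "n = 0" by (auto simp: S_def)
    with z that show False by simp
  qed
  have fhol: "f holomorphic_on S - {0}"
    unfolding f_def using sin0 
    by (intro holomorphic_intros holomorphic_on_subset[OF H]) auto
  have res: "residue f 0 = H 0"
  \<comment> \<open>The formula for simple poles is applied with a nonvanishing numerator. If H 0 =
    0 the singularity is removable: after division by z, numerator and denominator extend
    holomorphically, and the new denominator \<open>k\<close> has no zeros in S.\<close>
  proof (cases "H 0 = 0")
    case True
    define g where "g z = (if z = 0 then deriv H 0 else H z / z)" for z
    define k where "k z = (if z = 0 then deriv (\<lambda>z. sin (of_real pi * z)) 0 else sin (of_real pi * z) / z)" for z :: complex
    have d: "deriv (\<lambda>z. sin (of_real pi * z)) (0::complex) = of_real pi"
      by (rule DERIV_imp_deriv) (auto intro!: derivative_eq_intros)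
    have g: "g holomorphic_on S"
      using pole_theorem_open_0[OF holomorphic_on_subset[OF H] S(1), where f = g and a = 0] True
      unfolding g_def by auto
    have k: "k holomorphic_on S"
      using pole_theorem_open_0[OF _ S(1), where g = "\<lambda>z. sin (of_real pi * z)" and f = k and a = 0]
      unfolding k_def by (auto intro!: holomorphic_intros)
    have "residue f 0 = residue (\<lambda>z. of_real pi * g z / k z) 0"
      by (rule residue_cong) (auto simp: f_def g_def k_def eventually_at_filter)
    also have "\<dots> = 0"
    proof (rule residue_holo[OF S(1)])
      have "k z \<noteq> 0" if "z \<in> S" for z using sin0[OF that] d by (auto simp: k_def)
      then show "(\<lambda>z. of_real pi * g z / k z) holomorphic_on S" by (intro holomorphic_intros g k)
    qed (simp add: S_def)
    finally show ?thesis using True by simp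
  next
    case False
    have "residue f 0 = (of_real pi * H 0) / of_real pi"
      unfolding f_def
      by (rule residue_simple_pole_deriv[of _ S])
        (use S False in \<open>auto simp: S_def intro!: holomorphic_intros holomorphic_on_subset[OF H] derivative_eq_intros convex_connected\<close>)
    then show ?thesis by simp
  qed
  define p1 where "p1 = Complex (c - 1) (-T)"
  define p2 where "p2 = Complex c (-T)"
  define p3 where "p3 = Complex c T"
  define p4 where "p4 = Complex (c - 1) T"
  have rp: "rectpath p1 p3 = linepath p1 p2 +++ linepath p2 p3 +++ linepath p3 p4 +++ linepath p4 p1"
    by (simp add: rectpath_def p1_def p2_def p3_def p4_def Let_def)
  have 0: "0 \<in> box p1 p3" using c T by (simp add: in_box_complex_iff p1_def p3_def)
  have pI: "path_image (rectpath p1 p3) \<subseteq> S - {0}"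
  proof -
    have "path_image (rectpath p1 p3) = cbox p1 p3 - box p1 p3"
      using c T by (intro path_image_rectpath_cbox_minus_box) (auto simp: p1_def p3_def)
    moreover have "cbox p1 p3 \<subseteq> S" using c by (auto simp: in_cbox_complex_iff S_def p1_def p3_def)
    ultimately show ?thesis using 0 by auto
  qed
  have "contour_integral (rectpath p1 p3) f
      = 2 * pi * \<i> * (\<Sum>p\<in>{0}. winding_number (rectpath p1 p3) p * residue f p)"
  proof (rule Residue_theorem[of S])
    show "\<forall>z. z \<notin> S \<longrightarrow> winding_number (rectpath p1 p3) z = 0"
    proof safe
      fix z assume "z \<notin> S"
      then show "winding_number (rectpath p1 p3) z = 0"
        using c T by (intro winding_number_rectpath_outside)
           (auto simp: p1_def p3_def S_def in_cbox_complex_iff)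
    qed
  qed (use S fhol pI in \<open>auto intro: convex_connected\<close>)
  then have tot: "contour_integral (rectpath p1 p3) f = 2 * pi * \<i> * H 0"
    using winding_number_rectpath[OF 0] res by simp
  have sub: "closed_segment p1 p2 \<subseteq> S - {0}" "closed_segment p2 p3 \<subseteq> S - {0}"
      "closed_segment p3 p4 \<subseteq> S - {0}" "closed_segment p4 p1 \<subseteq> S - {0}"
    using pI unfolding rp by (auto simp: path_image_join)
  have cont: "continuous_on (S - {0}) f" by (rule holomorphic_on_imp_continuous_on[OF fhol])
  have ci: "f contour_integrable_on linepath p1 p2" "f contour_integrable_on linepath p2 p3"
      "f contour_integrable_on linepath p3 p4" "f contour_integrable_on linepath p4 p1"
    using sub by (auto intro!: contour_integrable_continuous_linepath continuous_on_subset[OF cont])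
  have split: "contour_integral (rectpath p1 p3) f = contour_integral (linepath p1 p2) f
     + contour_integral (linepath p2 p3) f + contour_integral (linepath p3 p4) f + contour_integral (linepath p4 p1) f"
    unfolding rp using ci by simp
  have v1: "contour_integral (linepath p2 p3) f = \<i> * integral {-T..T} (\<lambda>t. f (Complex c t))"
    using T by (intro contour_integral_linepath_same_Re) (auto simp: p2_def p3_def)
  have "contour_integral (linepath p1 p4) f = \<i> * integral {-T..T} (\<lambda>t. f (Complex (c-1) t))"
    using T by (intro contour_integral_linepath_same_Re) (auto simp: p1_def p4_def)
  then have v2: "contour_integral (linepath p4 p1) f = - (\<i> * integral {-T..T} (\<lambda>t. f (Complex (c-1) t)))"
    using contour_integral_reverse_linepath[of p1 p4 f] sub(4) cont
    by (simp add: continuous_on_subset closed_segment_commute)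
  let ?M = "pi * D * exp (b * T) / sinh (pi * T)"
  have M: "0 \<le> ?M" using D T by simp
  have fb: "norm (f z) \<le> ?M" if z: "c - 1 \<le> Re z" "Re z \<le> c" "\<bar>Im z\<bar> = T" for z
  proof -
    have "sinh (pi * T) \<le> norm (sin (of_real pi * z))"
      using norm_sin_ge_sinh[of "of_real pi * z"] z by (simp add: abs_mult)
    then have "norm (f z) \<le> (pi * (D * exp (b * T))) / sinh (pi * T)"
      unfolding f_def norm_divide norm_mult using bound[OF z(1,2)] z(3) D T
      by (intro frac_le mult_mono) auto
    then show ?thesis by (simp add: mult.assoc)
  qed
  have h1: "norm (contour_integral (linepath p1 p2) f) \<le> ?M"
  proof -
    have "norm (contour_integral (linepath p1 p2) f) \<le> ?M * norm (p2 - p1)"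
    proof (rule contour_integral_bound_linepath[OF ci(1) M])
      fix x assume "x \<in> closed_segment p1 p2"
      then have "Im x = -T" "Re x \<in> closed_segment (Re p1) (Re p2)"
        using closed_segment_same_Im[of p1 p2] by (auto simp: p1_def p2_def)
      then show "norm (f x) \<le> ?M" using T 
        by (intro fb) (auto simp: closed_segment_eq_real_ivl p1_def p2_def)
    qed
    also have "p2 - p1 = 1" by (simp add: p1_def p2_def complex_eq_iff)
    finally show ?thesis by simp
  qed
  have h2: "norm (contour_integral (linepath p3 p4) f) \<le> ?M"
  proof -
    have "norm (contour_integral (linepath p3 p4) f) \<le> ?M * norm (p4 - p3)"
    proof (rule contour_integral_bound_linepath[OF ci(3) M])
      fix x assume "x \<in> closed_segment p3 p4"
      then have "Im x = T" "Re x \<in> closed_segment (Re p3) (Re p4)"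
        using closed_segment_same_Im[of p3 p4] by (auto simp: p3_def p4_def)
      then show "norm (f x) \<le> ?M" using T 
        by (intro fb) (auto simp: closed_segment_eq_real_ivl p3_def p4_def)
    qed
    also have "p4 - p3 = -1" by (simp add: p3_def p4_def complex_eq_iff)
    finally show ?thesis by simp
  qed
  have shift: "f (Complex (c-1) t) = - (of_real pi * H (Complex (c-1) t) / sin (of_real pi * Complex c t))" for t
  proof -
    have "Complex (c-1) t = Complex c t - 1" by (simp add: complex_eq_iff)
    then have "sin (of_real pi * Complex (c-1) t) = sin (of_real pi * Complex c t - of_real pi)"
      by (simp only:) (simp add: right_diff_distrib)
    also have "\<dots> = - sin (of_real pi * Complex c t)" 
      by (simp add: sin_diff sin_of_real cos_of_real)
    finally show ?thesis by (simp add: f_def)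
  qed
  have int: "(\<lambda>t. f (Complex c t)) integrable_on {-T..T}" "(\<lambda>t. f (Complex (c-1) t)) integrable_on {-T..T}"
    using c by (auto intro!: integrable_continuous_real continuous_on_compose2[OF cont] continuous_on_Complex_line simp: S_def complex_eq_iff)
  have "integral {-T..T} (\<lambda>t. (H (Complex c t) + H (Complex (c - 1) t))
                  * (of_real pi / sin (of_real pi * Complex c t)))
     = integral {-T..T} (\<lambda>t. f (Complex c t) - f (Complex (c-1) t))"
    by (simp add: shift) (simp add: f_def field_simps add_divide_distrib)
  also have "\<dots> = integral {-T..T} (\<lambda>t. f (Complex c t)) - integral {-T..T} (\<lambda>t. f (Complex (c-1) t))"
    using int by (rule integral_diff)
  finally have e: "integral {-T..T} (\<lambda>t. (H (Complex c t) + H (Complex (c - 1) t))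
                  * (of_real pi / sin (of_real pi * Complex c t)))
     = integral {-T..T} (\<lambda>t. f (Complex c t)) - integral {-T..T} (\<lambda>t. f (Complex (c-1) t))" .
  have "\<i> * (integral {-T..T} (\<lambda>t. (H (Complex c t) + H (Complex (c - 1) t))
                  * (of_real pi / sin (of_real pi * Complex c t))) - 2 * pi * H 0)
      = - (contour_integral (linepath p1 p2) f + contour_integral (linepath p3 p4) f)"
    unfolding e using tot unfolding split v1 v2 by (simp add: algebra_simps add_eq_0_iff)
  from arg_cong[OF this, of norm]
  have "norm (integral {-T..T} (\<lambda>t. (H (Complex c t) + H (Complex (c - 1) t))
                  * (of_real pi / sin (of_real pi * Complex c t))) - 2 * pi * H 0)
      = norm (contour_integral (linepath p1 p2) f + contour_integral (linepath p3 p4) f)"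
    unfolding norm_minus_cancel norm_mult by simp
  also have "\<dots> \<le> ?M + ?M" by (rule norm_triangle_mono[OF h1 h2])
  finally show ?thesis unfolding mult_2 .
qed


text \<open>The limit T to infinity of \<open>rectangle_sin\<close>. The horizontal sides contribute
  at most a multiple of exp (b T) / sinh (pi T), which vanishes because b < pi.\<close>

lemma integral_sin_line_residue:
  fixes H :: "complex \<Rightarrow> complex"
  assumes H: "H holomorphic_on UNIV" and c: "0 < c" "c < 1" and b: "b < pi" "0 \<le> b"
    and bound: "\<And>z. c - 1 \<le> Re z \<Longrightarrow> Re z \<le> c \<Longrightarrow> norm (H z) \<le> D * exp (b * \<bar>Im z\<bar>)"
  shows "(LINT t|lborel. H (Complex c t) * (of_real pi / sin (of_real pi * Complex c t)))
       + (LINT t|lborel. H (Complex (c - 1) t) * (of_real pi / sin (of_real pi * Complex c t))) = 2 * pi * H 0"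
proof -
  let ?g = "\<lambda>t. (H (Complex c t) + H (Complex (c - 1) t)) * (of_real pi / sin (of_real pi * Complex c t))"
  have i: "integrable lborel (\<lambda>t. H (Complex c t) * (of_real pi / sin (of_real pi * Complex c t)))"
      "integrable lborel (\<lambda>t. H (Complex (c - 1) t) * (of_real pi / sin (of_real pi * Complex c t)))"
    using bound[of "Complex c t" for t] bound[of "Complex (c - 1) t" for t] c
    by (intro integrable_sin_line[OF c b(1), where D = D] measurable_on_line[OF H]; simp)+
  then have ig: "integrable lborel ?g"
    unfolding distrib_right by (rule Bochner_Integration.integrable_add)
  have lim: "(\<lambda>n. LINT t|lborel. indicator {-real n..real n} t *\<^sub>R ?g t) \<longlonglongrightarrow> (LINT t|lborel. ?g t)"
  proof (rule integral_dominated_convergence[where w = "\<lambda>t. norm (?g t)"])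
    have "(\<lambda>n. indicator {-real n..real n} t *\<^sub>R ?g t) \<longlonglongrightarrow> ?g t" for t
    proof (rule tendsto_eventually)
      obtain m :: nat where "\<bar>t\<bar> \<le> real m" using real_arch_simple by blast
      then show "\<forall>\<^sub>F n in sequentially. indicator {-real n..real n} t *\<^sub>R ?g t = ?g t"
        by (intro eventually_sequentiallyI[of m]) (auto simp: indicator_def)
    qed
    then show "AE t in lborel. (\<lambda>n. indicator {-real n..real n} t *\<^sub>R ?g t) \<longlonglongrightarrow> ?g t" by simp
  qed (use ig in \<open>auto simp: indicator_def\<close>)
  have eq: "(LINT t|lborel. indicator {-real n..real n} t *\<^sub>R ?g t) = integral {-real n..real n} ?g" for n
    using set_borel_integral_eq_integral(2)[of "{-real n..real n}" ?g] integrable_mult_indicator[OF _ ig, of "{-real n..real n}"]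
    by (simp add: set_lebesgue_integral_def set_integrable_def)
  have "(\<lambda>n. integral {-real n..real n} ?g - 2 * pi * H 0) \<longlonglongrightarrow> 0"
  proof (rule Lim_null_comparison)
    show "\<forall>\<^sub>F n in sequentially. norm (integral {-real n..real n} ?g - 2 * pi * H 0)
        \<le> 2 * (pi * D * exp (b * real n) / sinh (pi * real n))"
      using rectangle_sin[OF H c b bound] by (intro eventually_sequentiallyI[of 1]) simp
    have "((\<lambda>x::real. 2 * (pi * D * exp (b * x) / sinh (pi * x))) \<longlongrightarrow> 0) at_top"
    proof -
      have "((\<lambda>x::real. exp (b * x) / sinh (pi * x)) \<longlongrightarrow> 0) at_top"
      proof (rule Lim_null_comparison)
        \<comment> \<open>The 4 stems from sinh (pi x) >= exp (pi x) / 4, valid for x >= 1.\<close>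
        have "norm (exp (b * x) / sinh (pi * x)) \<le> 4 * exp (- ((pi - b) * x))" if x: "x \<ge> 1" for x
        proof -
          have "exp (- (pi * x)) \<le> exp (pi * x) / 2"
          proof -
            have "pi \<le> pi * x" using x by simp
            then have "1 \<le> pi * x" using pi_gt3 by linarith
            then have "2 \<le> exp (pi * x) * exp (pi * x)"
              using exp_ge_add_one_self[of "pi * x + pi * x"] unfolding exp_add by linarith
            then show ?thesis by (simp add: exp_minus field_simps)
          qed
          then have "exp (pi * x) / 4 \<le> sinh (pi * x)" by (simp add: sinh_field_def)
          then have "exp (b * x) / sinh (pi * x) \<le> exp (b * x) / (exp (pi * x) / 4)"
            by (intro frac_le) simp_all
          also have "\<dots> = 4 * exp (- ((pi - b) * x))"
            by (simp add: exp_minus exp_diff algebra_simps)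
          finally show ?thesis using x by simp
        qed
        then show "\<forall>\<^sub>F x in at_top. norm (exp (b * x) / sinh (pi * x)) \<le> 4 * exp (- ((pi - b) * x))"
          using eventually_at_top_linorder by blast
        show "((\<lambda>x. 4 * exp (- ((pi - b) * x))) \<longlongrightarrow> 0) at_top"
          using tendsto_mult[OF tendsto_const filterlim_compose[OF exp_at_bot filterlim_compose[OF filterlim_uminus_at_bot_at_top filterlim_tendsto_pos_mult_at_top[OF tendsto_const _ filterlim_ident]]], of "pi - b" 4] b by simp
      qed
      from tendsto_mult_right_zero[OF this, of "2 * (pi * D)"] show ?thesis by (simp add: algebra_simps)
    qed
    from filterlim_compose[OF this filterlim_real_sequentially]
    show "(\<lambda>n. 2 * (pi * D * exp (b * real n) / sinh (pi * real n))) \<longlonglongrightarrow> 0" .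
  qed
  then have "(\<lambda>n. integral {-real n..real n} ?g) \<longlonglongrightarrow> 2 * pi * H 0"
    by (simp add: LIM_zero_iff)
  with lim have "(LINT t|lborel. ?g t) = 2 * pi * H 0"
    unfolding eq by (rule LIMSEQ_unique)
  then show ?thesis
    unfolding distrib_right Bochner_Integration.integral_add[OF i] by simp
qed

section \<open>Growth of the reciprocal Gamma function in vertical strips\<close>

text \<open>In the product formula the quotient |rGamma (x + i y)| / rGamma x has the factors |x + k
  + i y| / (x + k), each decreasing in x. So the quotient is largest at x = 1, where it can be
  computed.\<close>

lemma rGamma_series_le:
  assumes x: "x \<ge> 1"
  shows "norm (rGamma_series (Complex x y) n) * rGamma_series 1 n \<le> rGamma_series x n * norm (rGamma_series (Complex 1 y) n)"
proof -
  have "norm (pochhammer (Complex x y) m) * pochhammer 1 m \<le> pochhammer x m * norm (pochhammer (Complex 1 y) m)" for m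
  proof -
    have "norm (pochhammer (Complex x y) m) * pochhammer 1 m = (\<Prod>k=0..<m. norm (Complex x y + of_nat k) * (1 + real k))"
      by (simp add: pochhammer_prod prod.distrib flip: prod_norm)
    also have "\<dots> \<le> (\<Prod>k=0..<m. (x + real k) * norm (Complex 1 y + of_nat k))"
    proof (rule prod_mono, safe)
      fix k
      have e: "Complex x y + of_nat k = Complex (x + real k) y" "Complex 1 y + of_nat k = Complex (1 + real k) y"
        by (simp_all add: complex_eq_iff)
      have "(norm (Complex (x + real k) y) * (1 + real k))\<^sup>2 \<le> ((x + real k) * norm (Complex (1 + real k) y))\<^sup>2"
      proof -
        have "y\<^sup>2 * (1 + real k)\<^sup>2 \<le> y\<^sup>2 * (x + real k)\<^sup>2" using x by (intro mult_left_mono power_mono) auto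
        then show ?thesis unfolding power_mult_distrib cmod_power2 complex.sel by (simp add: algebra_simps)
      qed
      then show "norm (Complex x y + of_nat k) * (1 + real k) \<le> (x + real k) * norm (Complex 1 y + of_nat k)"
        unfolding e by (rule power2_le_imp_le) (use x in simp)
    qed auto
    also have "\<dots> = pochhammer x m * norm (pochhammer (Complex 1 y) m)"
      by (simp add: pochhammer_prod prod.distrib flip: prod_norm)
    finally show ?thesis .
  qed
  from this[of "n + 1"] have le: "norm (pochhammer (Complex x y) (n + 1)) * pochhammer 1 (n + 1)
      \<le> pochhammer x (n + 1) * norm (pochhammer (Complex 1 y) (n + 1))" .
  define e where "e x = fact n * exp (x * ln (real n))" for x
  have e: "e x > 0" for x by (simp add: e_def)
  have "norm (rGamma_series (Complex x y) n) = norm (pochhammer (Complex x y) (n + 1)) / e x" for x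
    by (simp add: rGamma_series_def norm_divide norm_mult e_def del: pochhammer_Suc)
  moreover have "rGamma_series x n = pochhammer x (n + 1) / e x" for x
    by (simp add: rGamma_series_def e_def del: pochhammer_Suc)
  ultimately show ?thesis
    using divide_right_mono[OF le, of "e x * e 1"] e[of x] e[of 1] by simp
qed

text \<open>The reflection formula together with rGamma (- i y) = - i y rGamma (1 - i y) gives
  |rGamma (1 + i y)|^2 = sinh (pi |y|) / (pi |y|) for y \<noteq> 0, and sinh u <= u exp u.\<close>

lemma norm_rGamma_1_le: "norm (rGamma (Complex 1 y)) \<le> exp (pi / 2 * \<bar>y\<bar>)"
proof (cases "y = 0")
  case True
  then have "Complex 1 y = 1" by (simp add: complex_eq_iff)
  then show ?thesis using True by simp
next
  case False
  define z where "z = Complex 1 y"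
  have z: "1 - z = - (\<i> * y)" "cnj z = 1 - \<i> * y" by (simp_all add: z_def complex_eq_iff)
  have "rGamma (1 - z) = - (\<i> * y) * cnj (rGamma z)"
    using rGamma_plus1[of "- (\<i> * y)"] z by (simp add: cnj_rGamma)
  then have "norm (rGamma z) * norm (rGamma (1 - z)) = (norm (rGamma z))\<^sup>2 * \<bar>y\<bar>"
    by (simp add: norm_mult power2_eq_square)
  then have "(norm (rGamma z))\<^sup>2 * \<bar>y\<bar> = norm (sin (of_real pi * z)) / pi"
    using arg_cong[OF rGamma_reflection_complex[of z], of norm] by (simp add: norm_mult norm_divide)
  also have "norm (sin (of_real pi * z)) = sinh (pi * \<bar>y\<bar>)"
  proof (rule power2_eq_imp_eq)
    show "(norm (sin (of_real pi * z)))\<^sup>2 = (sinh (pi * \<bar>y\<bar>))\<^sup>2"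
      unfolding norm_sin_squared_cosh
      by (simp add: z_def sinh_square_eq) (metis abs_mult abs_of_nonneg cosh_real_abs pi_ge_zero)
  qed auto
  also have "sinh (pi * \<bar>y\<bar>) \<le> pi * \<bar>y\<bar> * exp (pi * \<bar>y\<bar>)"
  proof -
    define u where "u = pi * \<bar>y\<bar>"
    have "1 - 2 * u \<le> exp (- (2 * u))" using exp_ge_add_one_self[of "-2*u"] by simp
    then have "(1 - 2 * u) * exp u \<le> exp (- (2 * u)) * exp u" by (rule mult_right_mono) auto
    then have "(1 - 2 * u) * exp u \<le> exp (- u)" by (simp flip: exp_add)
    then show ?thesis unfolding u_def[symmetric] by (simp add: sinh_field_def algebra_simps)
  qed
  finally have "(norm (rGamma z))\<^sup>2 * \<bar>y\<bar> \<le> exp (pi * \<bar>y\<bar>) * \<bar>y\<bar>"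
    by (simp add: divide_right_mono algebra_simps)
  then have "(norm (rGamma z))\<^sup>2 \<le> exp (pi * \<bar>y\<bar>)" using False by simp
  also have "\<dots> = (exp (pi / 2 * \<bar>y\<bar>))\<^sup>2" by (simp add: power2_eq_square flip: exp_add)
  finally show ?thesis unfolding z_def by (rule power2_le_imp_le) auto
qed

text \<open>The explicit factor \<open>rGamma x\<close> is essential: it makes the Mellin-Barnes
  integrals over lines far to the left tend to zero, for which a strip bound with an unspecified
  constant would not do.\<close>

lemma norm_rGamma_le:
  assumes "x \<ge> 1"
  shows "norm (rGamma (Complex x y)) \<le> rGamma x * exp (pi / 2 * \<bar>y\<bar>)"
proof -
  have "norm (rGamma (Complex x y)) * rGamma 1 \<le> rGamma x * norm (rGamma (Complex 1 y))"
  proof (rule LIMSEQ_le)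
    show "\<exists>N. \<forall>n\<ge>N. norm (rGamma_series (Complex x y) n) * rGamma_series 1 n
        \<le> rGamma_series x n * norm (rGamma_series (Complex 1 y) n)"
      using rGamma_series_le[OF assms] by blast
  qed (intro tendsto_intros)+
  also have "\<dots> \<le> rGamma x * exp (pi / 2 * \<bar>y\<bar>)"
    using assms by (intro mult_left_mono norm_rGamma_1_le) (auto simp: rGamma_inverse_Gamma)
  finally show ?thesis by simp
qed

text \<open>Continues the bound to the left of Re z = 1 through rGamma z = z rGamma (z + 1), one
  unit per induction step. Each step costs a factor |z|, which an arbitrarily small exponential
  absorbs; hence the strict inequality b > pi / 2.\<close>

lemma rGamma_strip_bound:
  assumes "b > pi / 2"
  shows "\<exists>D\<ge>0. \<forall>z. x0 \<le> Re z \<and> Re z \<le> x1 \<longrightarrow> norm (rGamma z) \<le> D * exp (b * \<bar>Im z\<bar>)"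
proof -
  have *: "\<exists>D\<ge>0. \<forall>z. 1 - real m \<le> Re z \<and> Re z \<le> x1 \<longrightarrow> norm (rGamma z) \<le> D * exp (b * \<bar>Im z\<bar>)"
    if "b > pi / 2" for m x1 b
    using that
  proof (induction m arbitrary: x1 b)
    case 0
    have "bounded (rGamma ` {1..x1})"
      by (intro compact_imp_bounded compact_continuous_image continuous_on_rGamma) auto
    then obtain B where B: "B > 0" "\<And>x. 1 \<le> x \<Longrightarrow> x \<le> x1 \<Longrightarrow> norm (rGamma x) \<le> B"
      unfolding bounded_pos by auto
    show ?case
    proof (intro exI[of _ B] conjI allI impI)
      fix z assume z: "1 - real 0 \<le> Re z \<and> Re z \<le> x1"
      have "norm (rGamma z) \<le> rGamma (Re z) * exp (pi / 2 * \<bar>Im z\<bar>)"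
        using norm_rGamma_le[of "Re z" "Im z"] z by simp
      also have "\<dots> \<le> B * exp (b * \<bar>Im z\<bar>)"
        using B(2)[of "Re z"] z B(1) mult_right_mono[of "pi / 2" b "\<bar>Im z\<bar>"] 0 by (intro mult_mono) auto
      finally show "norm (rGamma z) \<le> B * exp (b * \<bar>Im z\<bar>)" .
    qed (use B in auto)
  next
    case (Suc m)
    \<comment> \<open>Half of the room above pi / 2 pays for the factor |z| of this step; the other
      half is left to the induction hypothesis, which is therefore general in b.\<close>
    define e where "e = (b - pi / 2) / 2"
    have e: "e > 0" "b - e > pi / 2" using Suc.prems by (auto simp: e_def field_simps)
    from Suc.IH[OF e(2), of "x1 + 1"] obtain D where D: "D \<ge> 0"
      "\<And>z. 1 - real m \<le> Re z \<Longrightarrow> Re z \<le> x1 + 1 \<Longrightarrow> norm (rGamma z) \<le> D * exp ((b - e) * \<bar>Im z\<bar>)"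
      by blast
    show ?case
    proof (intro exI[of _ "(real m + \<bar>x1\<bar> + 1 / e) * D"] conjI allI impI)
      fix z assume z: "1 - real (Suc m) \<le> Re z \<and> Re z \<le> x1"
      have "norm z \<le> \<bar>Re z\<bar> + \<bar>Im z\<bar>" by (rule cmod_le)
      also have "\<dots> \<le> (real m + \<bar>x1\<bar>) * 1 + (1 / e) * (e * \<bar>Im z\<bar>)" using z e by auto
      also have "\<dots> \<le> (real m + \<bar>x1\<bar>) * exp (e * \<bar>Im z\<bar>) + (1 / e) * exp (e * \<bar>Im z\<bar>)"
        using e exp_ge_add_one_self[of "e * \<bar>Im z\<bar>"] by (intro add_mono mult_left_mono) (auto intro: order.trans[rotated] simp del: exp_ge_add_one_self)
      finally have nz: "norm z \<le> (real m + \<bar>x1\<bar> + 1 / e) * exp (e * \<bar>Im z\<bar>)" by (simp add: algebra_simps)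
      have "norm (rGamma z) = norm z * norm (rGamma (z + 1))"
        using rGamma_plus1[of z] by (simp flip: norm_mult)
      also have "\<dots> \<le> ((real m + \<bar>x1\<bar> + 1 / e) * exp (e * \<bar>Im z\<bar>)) * (D * exp ((b - e) * \<bar>Im z\<bar>))"
        using D(2)[of "z + 1"] z nz order.trans[OF norm_ge_zero nz] by (intro mult_mono) auto
      also have "\<dots> = (real m + \<bar>x1\<bar> + 1 / e) * D * exp (b * \<bar>Im z\<bar>)"
        by (simp add: mult_exp_exp algebra_simps)
      finally show "norm (rGamma z) \<le> (real m + \<bar>x1\<bar> + 1 / e) * D * exp (b * \<bar>Im z\<bar>)" .
    qed (use D e in auto)
  qed
  obtain m :: nat where "1 - x0 \<le> real m" using real_arch_simple by blast
  then have m: "1 - real m \<le> x0" by linarith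
  obtain D where "D \<ge> 0"
    "\<forall>z. 1 - real m \<le> Re z \<and> Re z \<le> x1 \<longrightarrow> norm (rGamma z) \<le> D * exp (b * \<bar>Im z\<bar>)"
    using *[OF assms] by blast
  with m show ?thesis by (intro exI[of _ D]) auto
qed

section \<open>Power series with reciprocal Gamma coefficients\<close>

lemma eventually_rGamma_le_inverse_fact:
  fixes a b :: real
  assumes "a > 1"
  shows "\<forall>\<^sub>F n in sequentially. 0 \<le> rGamma (b + a * real n) \<and> rGamma (b + a * real n) \<le> inverse (fact n)"
proof -
  have "b + a * real n \<ge> 1 + real n" if "real n \<ge> (1 - b) / (a - 1)" for n
    using that assms by (simp add: field_simps)
  then have "\<forall>\<^sub>F n in sequentially. b + a * real n \<ge> 1 + real n"
    using eventually_ge_at_top[of "nat \<lceil>(1 - b) / (a - 1)\<rceil>"] by (auto elim!: eventually_mono)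
  with eventually_ge_at_top[of 1] show ?thesis
  proof eventually_elim
    case (elim n)
    have "fact n = Gamma (1 + real n)" by (simp add: Gamma_fact)
    also have "\<dots> \<le> Gamma (b + a * real n)"
      using Gamma_real_strict_mono[of "1 + real n" "b + a * real n"] elim
      by (cases "b + a * real n = 1 + real n") auto
    finally show ?case
      using elim fact_gt_zero[of n, where 'a = real] by (auto simp: rGamma_inverse_Gamma intro!: le_imp_inverse_le)
  qed
qed

lemma summable_power_rGamma:
  fixes a b :: real and z :: "'a :: {banach, real_normed_field}"
  assumes "a > 1"
  shows "summable (\<lambda>n. norm (z ^ n * of_real (rGamma (b + a * real n))))"
proof (rule summable_comparison_test_ev[OF _ summable_norm_exp[of z]])
  show "\<forall>\<^sub>F n in sequentially. norm (norm (z ^ n * of_real (rGamma (b + a * real n)))) \<le> norm (z ^ n /\<^sub>R fact n)"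
    using eventually_rGamma_le_inverse_fact[OF assms, of b]
  proof eventually_elim
    case (elim n)
    then have "norm z ^ n * rGamma (b + a * real n) \<le> norm z ^ n * inverse (fact n)"
      by (intro mult_left_mono) auto
    with elim show ?case by (simp add: norm_mult norm_power mult.commute)
  qed
qed

text \<open>The Mittag-Leffler function at \<open>-z\<close> is the Mellin-Barnes integral over the line \<open>Re w = c\<close>: up to
  sign, the integral \<open>A k\<close> over \<open>Re w = c - k\<close> is moved across the pole \<open>w = -k\<close>, which produces the \<open>k\<close>-th term of the
  power series, and \<open>A k\<close> tends to \<open>0\<close>.\<close>

lemma Mittag_Leffler_bound:
  fixes a b c :: real
  assumes a: "1 < a" "a < 2" and c: "0 < c" "c < 1"
  shows "\<exists>M\<ge>0. \<forall>z>0. \<bar>\<Sum>n. (- z) ^ n * rGamma (b + a * real n)\<bar> \<le> M * z powr (- c)"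
proof -
  \<comment> \<open>The midpoint between pi a / 2, the growth rate of rGamma (b - a w) along the
    line, and pi, the decay rate of pi / sin.\<close>
  define p where "p = pi * (2 + a) / 4"
  have p: "0 \<le> p" "p < pi" "p / a > pi / 2" "pi / 2 * a \<le> p"
    using a by (auto simp: p_def field_simps)
  obtain D where D: "D \<ge> 0"
    "\<And>z. b - a * c \<le> Re z \<Longrightarrow> Re z \<le> b - a * (c - 1) \<Longrightarrow> norm (rGamma z) \<le> D * exp (p / a * \<bar>Im z\<bar>)"
    using rGamma_strip_bound[OF p(3), of "b - a * c" "b - a * (c - 1)"] by blast
  have main: "\<bar>\<Sum>n. (- z) ^ n * rGamma (b + a * real n)\<bar> \<le> D * sin_line_const p c / (2 * pi) * z powr (- c)"
    if z: "z > 0" for z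
  proof -
    \<comment> \<open>The integrand z powr (- w) rGamma (b - a w) translated by k, so that every
      line becomes Re w = c and every pole sits at 0, where \<open>integral_sin_line_residue\<close>
      applies. The sign (-1)^k picked up by the sine is left out and restored in
      \<open>part\<close>.\<close>
    define H where "H k w = exp ((of_nat k - w) * of_real (ln z)) * rGamma (of_real (b + a * real k) - of_real a * w)"
      for k :: nat and w :: complex
    define A where "A k = (LINT t|lborel. H k (Complex c t) * (of_real pi / sin (of_real pi * Complex c t)))" for k
    have Hhol: "H k holomorphic_on UNIV" for k
      unfolding H_def by (intro holomorphic_intros)
    have nH: "norm (H k w) = z powr (real k - Re w) * norm (rGamma (of_real (b + a * real k) - of_real a * w))" for k w
      using z by (simp add: H_def norm_mult powr_def mult.commute)
    have shift: "H k (Complex (c - 1) t) = H (Suc k) (Complex c t)" for k t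
    proof -
      have "Complex (c - 1) t = Complex c t - 1" by (simp add: complex_eq_iff)
      then show ?thesis unfolding H_def by (simp only:) (simp add: algebra_simps)
    qed
    have A_add: "A k + A (Suc k) = of_real (2 * pi) * (of_real z ^ k * of_real (rGamma (b + a * real k)))" for k
    proof -
      obtain D' where D': "D' \<ge> 0" "\<And>w. b + a * real k - a * c \<le> Re w \<Longrightarrow> Re w \<le> b + a * real k - a * (c - 1)
          \<Longrightarrow> norm (rGamma w) \<le> D' * exp (p / a * \<bar>Im w\<bar>)"
        using rGamma_strip_bound[OF p(3), of "b + a * real k - a * c" "b + a * real k - a * (c - 1)"] by blast
      have "A k + A (Suc k) = 2 * pi * H k 0"
        unfolding A_def shift[symmetric]
      proof (rule integral_sin_line_residue[OF Hhol c p(2,1)])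
        fix w assume w: "c - 1 \<le> Re w" "Re w \<le> c"
        have "z powr (real k - Re w) \<le> max (z powr (real k - c)) (z powr (real k - (c - 1)))"
        proof (cases "z \<ge> 1")
          case True then show ?thesis using w by (intro max.coboundedI2 powr_mono) auto
        next
          case False then show ?thesis using w z by (intro max.coboundedI1 powr_mono') auto
        qed
        moreover have "norm (rGamma (of_real (b + a * real k) - of_real a * w)) \<le> D' * exp (p * \<bar>Im w\<bar>)"
          using D'(2)[of "of_real (b + a * real k) - of_real a * w"] w a
          by (simp add: abs_mult)
        ultimately show "norm (H k w) \<le> max (z powr (real k - c)) (z powr (real k - (c - 1))) * D' * exp (p * \<bar>Im w\<bar>)"
          unfolding nH mult.assoc using D' by (intro mult_mono) (auto simp: le_max_iff_disj)
      qed
      also have "H k 0 = of_real z ^ k * of_real (rGamma (b + a * real k))"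
        using z by (simp add: H_def exp_of_nat_mult exp_of_real flip: rGamma_complex_of_real)
      finally show ?thesis .
    qed
    have A0: "norm (A 0) \<le> z powr (- c) * D * sin_line_const p c"
      unfolding A_def
    proof (rule integral_sin_line_bound[OF c p(2) measurable_on_line[OF Hhol]])
      fix t
      have "norm (rGamma (of_real b - of_real a * Complex c t)) \<le> D * exp (p * \<bar>t\<bar>)"
        using D(2)[of "of_real b - of_real a * Complex c t"] c a by (simp add: abs_mult)
      then show "norm (H 0 (Complex c t)) \<le> z powr (- c) * D * exp (p * \<bar>t\<bar>)"
        unfolding nH by (auto simp: mult.assoc intro!: mult_left_mono)
    qed
    have A_lim: "A \<longlonglongrightarrow> 0"
    proof (rule Lim_null_comparison)
      have "b + a * real k - a * c \<ge> 1" if "real k \<ge> (1 - b + a * c) / a" for k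
        using that a by (simp add: field_simps)
      then have "\<forall>\<^sub>F k in sequentially. b + a * real k - a * c \<ge> 1"
        using eventually_ge_at_top[of "nat \<lceil>(1 - b + a * c) / a\<rceil>"] by (auto elim!: eventually_mono)
      then show "\<forall>\<^sub>F k in sequentially. norm (A k)
          \<le> z powr (- c) * norm (z ^ k * of_real (rGamma ((b - a * c) + a * real k))) * sin_line_const p c"
      proof eventually_elim
        case (elim k)
        show ?case unfolding A_def
        proof (rule integral_sin_line_bound[OF c p(2) measurable_on_line[OF Hhol]])
          fix t
          have e: "of_real (b + a * real k) - of_real a * Complex c t = Complex (b + a * real k - a * c) (- a * t)"
            by (simp add: complex_eq_iff)
          have "norm (rGamma (of_real (b + a * real k) - of_real a * Complex c t))
              \<le> rGamma (b + a * real k - a * c) * exp (pi / 2 * \<bar>- a * t\<bar>)"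
            unfolding e by (rule norm_rGamma_le[OF elim])
          also have "\<dots> \<le> rGamma (b + a * real k - a * c) * exp (p * \<bar>t\<bar>)"
          proof -
            have "pi / 2 * a * \<bar>t\<bar> \<le> p * \<bar>t\<bar>" using p by (intro mult_right_mono) auto
            then show ?thesis
              using elim a by (intro mult_left_mono) (auto simp: rGamma_inverse_Gamma abs_mult)
          qed
          finally show "norm (H k (Complex c t))
              \<le> z powr (- c) * norm (z ^ k * of_real (rGamma ((b - a * c) + a * real k))) * exp (p * \<bar>t\<bar>)"
            unfolding nH using z elim
            by (auto simp: powr_diff powr_minus powr_realpow divide_inverse abs_mult algebra_simps rGamma_inverse_Gamma
                intro!: mult_left_mono)
        qed
      qed
      have "(\<lambda>k. norm (z ^ k * of_real (rGamma ((b - a * c) + a * real k)))) \<longlonglongrightarrow> 0"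
        by (intro summable_LIMSEQ_zero summable_power_rGamma a)
      then show "(\<lambda>k. z powr (- c) * norm (z ^ k * of_real (rGamma ((b - a * c) + a * real k))) * sin_line_const p c) \<longlonglongrightarrow> 0"
        by (intro tendsto_mult_left_zero tendsto_mult_right_zero)
    qed
    let ?t = "\<lambda>n. (- z) ^ n * rGamma (b + a * real n)"
    \<comment> \<open>The alternating sum of the relations \<open>A_add\<close> telescopes.\<close>
    have part: "complex_of_real (2 * pi) * of_real (\<Sum>k<n. ?t k) = A 0 - (-1) ^ n * A n" for n
    proof (induction n)
      case (Suc n)
      have "complex_of_real (2 * pi) * of_real (?t n) = (-1) ^ n * (A n + A (Suc n))"
        unfolding A_add by (simp add: power_minus[of z])
      with Suc show ?case by (simp add: algebra_simps)
    qed simp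
    have "(\<lambda>n. (-1) ^ n * A n) \<longlonglongrightarrow> 0"
      using A_lim by (subst tendsto_norm_zero_iff[symmetric]) (simp add: norm_mult norm_power tendsto_norm_zero)
    then have "(\<lambda>n. A 0 - (-1) ^ n * A n) \<longlonglongrightarrow> A 0 - 0" by (intro tendsto_intros)
    moreover have "(\<lambda>n. complex_of_real (2 * pi) * of_real (\<Sum>k<n. ?t k)) \<longlonglongrightarrow> complex_of_real (2 * pi) * of_real (suminf ?t)"
      using summable_norm_cancel[OF summable_power_rGamma[OF a(1), of "-z" b]]
      by (intro tendsto_intros summable_LIMSEQ) simp
    ultimately have "A 0 = complex_of_real (2 * pi) * of_real (suminf ?t)"
      unfolding part by (simp add: LIMSEQ_unique)
    then have "2 * pi * \<bar>suminf ?t\<bar> = norm (A 0)" by (simp add: norm_mult)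
    with A0 have "2 * pi * \<bar>suminf ?t\<bar> \<le> z powr (- c) * D * sin_line_const p c" by simp
    then show ?thesis by (simp add: field_simps)
  qed
  have "0 \<le> sin_line_const p c"
    unfolding sin_line_const_def using c by (intro integral_nonneg_AE) (auto intro!: divide_nonneg_nonneg sin_ge_zero)
  then show ?thesis using main D by (intro exI[of _ "D * sin_line_const p c / (2 * pi)"]) auto
qed

section \<open>Entire functions of order less than one\<close>

text \<open>Borel-Caratheodory at one point: if \<open>Re g < K\<close> then \<open>g / (2 K - g)\<close> maps the unit disc into itself.\<close>

lemma norm_deriv_le_of_Re_less:
  assumes g: "g holomorphic_on ball 0 1" and g0: "g 0 = 0" and K: "\<And>w. norm w < 1 \<Longrightarrow> Re (g w) < K"
  shows "norm (deriv g 0) \<le> 2 * K"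
proof -
  have K0: "K > 0" using K[of 0] g0 by simp
  define \<phi> where "\<phi> w = g w / (of_real (2 * K) - g w)" for w
  \<comment> \<open>Because |2 K - g|^2 - |g|^2 = 4 K (K - Re g) > 0.\<close>
  have lt: "norm (g w) < norm (of_real (2 * K) - g w)" if "norm w < 1" for w
  proof (rule power2_less_imp_less)
    have "K * Re (g w) < K * K" using K[OF that] K0 by simp
    then show "(norm (g w))\<^sup>2 < (norm (of_real (2 * K) - g w))\<^sup>2"
      unfolding cmod_power2 by (simp add: power2_eq_square algebra_simps)
  qed auto
  have nz: "of_real (2 * K) - g w \<noteq> 0" if "norm w < 1" for w
    using lt[OF that] by (metis norm_not_less_zero norm_zero)
  have "norm (deriv \<phi> 0) \<le> 1"
  proof (rule Schwarz_Lemma(2)[of \<phi> 0])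
    show "\<phi> holomorphic_on ball 0 1"
      unfolding \<phi>_def using nz by (intro holomorphic_intros g) auto
    show "norm (\<phi> z) < 1" if "norm z < 1" for z
      using lt[OF that] nz[OF that] by (simp add: \<phi>_def norm_divide divide_less_eq)
  qed (auto simp: \<phi>_def g0)
  moreover have "deriv \<phi> 0 = deriv g 0 / of_real (2 * K)"
  proof (rule DERIV_imp_deriv)
    have "(g has_field_derivative deriv g 0) (at 0)"
      by (rule holomorphic_derivI[OF g]) auto
    then show "(\<phi> has_field_derivative deriv g 0 / of_real (2 * K)) (at 0)"
      unfolding \<phi>_def using K0 g0 by (auto intro!: derivative_eq_intros simp: field_simps)
  qed
  ultimately show ?thesis using K0 by (simp add: norm_divide divide_le_eq)
qed

text \<open>Scaling the disc of radius r around an arbitrary z0 to the unit disc bounds r |G' z0| by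
  O (r powr \<rho>) for large r. Since \<rho> < 1, letting r grow forces G' z0 = 0.\<close>

lemma entire_Re_growth_imp_constant:
  assumes G: "G holomorphic_on UNIV" and rho: "0 \<le> \<rho>" "\<rho> < 1" and C: "C \<ge> 0" and B: "B \<ge> 0"
    and bound: "\<And>z. Re (G z) \<le> A + B * (C + norm z) powr \<rho>"
  shows "G constant_on UNIV"
proof -
  have deriv0: "deriv G z0 = 0" for z0
  proof -
    define D where "D = C + norm z0"
    have D: "D \<ge> 0" using C by (simp add: D_def)
    \<comment> \<open>The term |Re (G z0)| pays for normalising the value at the centre to 0, and
      the 1 makes the bound on the real part strict.\<close>
    define c where "c = \<bar>A\<bar> + 1 + \<bar>Re (G z0)\<bar>"
    have le: "norm (deriv G z0) \<le> 2 * (c + B * (D + r) powr \<rho>) / r" if r: "r \<ge> 1" for r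
    proof -
      have "norm (deriv (\<lambda>w. G (z0 + of_real r * w) - G z0) 0) \<le> 2 * (c + B * (D + r) powr \<rho>)"
      proof (rule norm_deriv_le_of_Re_less)
        show "(\<lambda>w. G (z0 + of_real r * w) - G z0) holomorphic_on ball 0 1"
          by (intro holomorphic_intros holomorphic_on_compose_gen[OF _ G, unfolded o_def]) auto
        fix w :: complex assume w: "norm w < 1"
        have "norm (z0 + of_real r * w) \<le> norm z0 + norm (of_real r * w)" by (rule norm_triangle_ineq)
        also have "\<dots> \<le> norm z0 + r" using w r by (simp add: norm_mult mult_left_le)
        finally have "C + norm (z0 + of_real r * w) \<le> D + r" by (simp add: D_def)
        then have "(C + norm (z0 + of_real r * w)) powr \<rho> \<le> (D + r) powr \<rho>"
          using C rho by (intro powr_mono2) auto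
        then have "B * (C + norm (z0 + of_real r * w)) powr \<rho> \<le> B * (D + r) powr \<rho>"
          using B by (rule mult_left_mono)
        with bound[of "z0 + of_real r * w"]
        show "Re (G (z0 + of_real r * w) - G z0) < c + B * (D + r) powr \<rho>"
          by (simp add: c_def)
      qed auto
      moreover have "deriv (\<lambda>w. G (z0 + of_real r * w) - G z0) 0 = of_real r * deriv G z0"
      proof (rule DERIV_imp_deriv)
        have "(G has_field_derivative deriv G z0) (at (z0 + of_real r * 0))"
          using holomorphic_derivI[OF G] by simp
        then have "((\<lambda>w. G (z0 + of_real r * w)) has_field_derivative deriv G z0 * of_real r) (at 0)"
          by (rule DERIV_chain2) (auto intro!: derivative_eq_intros)
        then show "((\<lambda>w. G (z0 + of_real r * w) - G z0) has_field_derivative of_real r * deriv G z0) (at 0)"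
          by (auto intro!: derivative_eq_intros simp: mult.commute)
      qed
      ultimately show ?thesis using r by (simp add: norm_mult field_simps)
    qed
    have "norm (deriv G z0) \<le> 2 * c / r + 2 * B * 2 powr \<rho> * r powr (\<rho> - 1)" if r: "r \<ge> max 1 D" for r
    proof -
      have "(D + r) powr \<rho> \<le> (2 * r) powr \<rho>" using r D rho by (intro powr_mono2) auto
      then have "B * (D + r) powr \<rho> \<le> B * (2 powr \<rho> * r powr \<rho>)"
        using B r by (intro mult_left_mono) (auto simp: powr_mult)
      then have "2 * (c + B * (D + r) powr \<rho>) / r \<le> 2 * (c + B * (2 powr \<rho> * r powr \<rho>)) / r"
        using r by (intro divide_right_mono) auto
      also have "\<dots> = 2 * c / r + 2 * B * 2 powr \<rho> * r powr (\<rho> - 1)"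
        using r by (simp add: powr_diff field_simps)
      finally show ?thesis using le[of r] r by simp
    qed
    then have ev: "\<forall>\<^sub>F r in at_top. norm (deriv G z0) \<le> 2 * c / r + 2 * B * 2 powr \<rho> * r powr (\<rho> - 1)"
      using eventually_at_top_linorder by blast
    have "((\<lambda>r. 2 * c / r + 2 * B * 2 powr \<rho> * r powr (\<rho> - 1)) \<longlongrightarrow> 0 + 2 * B * 2 powr \<rho> * 0) at_top"
      using rho by (intro tendsto_intros tendsto_neg_powr tendsto_divide_0[OF tendsto_const]
          filterlim_at_top_imp_at_infinity filterlim_ident) auto
    from tendsto_lowerbound[OF this ev] show ?thesis by simp
  qed
  have "(G has_field_derivative 0) (at z within UNIV)" for z
    using holomorphic_derivI[OF G, of z] deriv0[of z] by simp
  then have "\<exists>c. \<forall>z\<in>UNIV. G z = c"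
    by (intro has_field_derivative_zero_constant) auto
  then show ?thesis by (simp add: constant_on_def)
qed

section \<open>Entire functions of slow growth with finitely many zeros\<close>

lemma entire_divide_zero:
  assumes F: "F holomorphic_on UNIV" and nz: "F w0 \<noteq> 0" and z0: "F z0 = 0"
  obtains g n where "g holomorphic_on UNIV" "n > 0" "\<And>z. F z = (z - z0) ^ n * g z" "g z0 \<noteq> 0"
proof -
  define n where "n = nat (zorder F z0)"
  define P where "P = zor_poly F z0"
  have "\<exists>w\<in>UNIV. F w \<noteq> 0" using nz by blast
  from zorder_exist_zero[OF F open_UNIV connected_UNIV UNIV_I this, of z0] z0
  obtain r where zo: "zorder F z0 > 0" and r: "r > 0" "P holomorphic_on cball z0 r"
    "\<And>w. w \<in> cball z0 r \<Longrightarrow> F w = P w * (w - z0) ^ n \<and> P w \<noteq> 0"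
    by (auto simp: P_def n_def split: if_splits)
  define g where "g z = (if z = z0 then P z0 else F z / (z - z0) ^ n)" for z
  have gP: "g z = P z" if "z \<in> ball z0 r" for z
    using r(3)[of z] that by (auto simp: g_def)
  have "g holomorphic_on (ball z0 r \<union> - {z0})"
  proof (rule holomorphic_on_Un)
    show "g holomorphic_on ball z0 r"
      by (rule holomorphic_transform[OF holomorphic_on_subset[OF r(2) ball_subset_cball]]) (simp add: gP)
    have "(\<lambda>z. F z / (z - z0) ^ n) holomorphic_on - {z0}"
      by (intro holomorphic_intros holomorphic_on_subset[OF F]) auto
    then show "g holomorphic_on - {z0}"
      by (rule holomorphic_transform) (auto simp: g_def)
  qed auto
  moreover have "ball z0 r \<union> - {z0} = UNIV" using r(1) by auto
  ultimately have "g holomorphic_on UNIV" by simp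
  moreover have "n > 0" using zo by (simp add: n_def)
  moreover from this have "F z = (z - z0) ^ n * g z" for z using z0 by (simp add: g_def)
  moreover have "g z0 \<noteq> 0" using r(3)[of z0] r(1) by (simp add: g_def)
  ultimately show thesis by (rule that)
qed

text \<open>P is the product of the powers of z minus a zero, but only |P| >= 1 far out is recorded.
  This serves in both directions: it bounds the zero-free factor by F, and F from below once that
  factor is constant.\<close>

lemma entire_finite_zeros_factorization:
  fixes F :: "complex \<Rightarrow> complex"
  assumes "finite Z" "F holomorphic_on UNIV" "{z. F z = 0} = Z"
  shows "\<exists>(P :: complex \<Rightarrow> complex) h R. h holomorphic_on UNIV \<and> (\<forall>z. h z \<noteq> 0) \<and> (\<forall>z. F z = P z * h z) \<and>
           (\<forall>z. norm z \<ge> R \<longrightarrow> norm (P z) \<ge> (1::real))"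
  using assms
proof (induction Z arbitrary: F rule: finite_induct)
  case empty
  then show ?case by (intro exI[of _ "\<lambda>_. 1"] exI[of _ F] exI[of _ 0]) auto
next
  case (insert z0 Z)
  then have z0: "F z0 = 0" by auto
  have "infinite (UNIV :: complex set)" by (rule infinite_UNIV_char_0)
  with insert.hyps insert.prems obtain w0 where "F w0 \<noteq> 0"
    by (metis (mono_tags, lifting) UNIV_eq_I finite_insert mem_Collect_eq)
  from entire_divide_zero[OF insert.prems(1) this z0] obtain g n where
    g: "g holomorphic_on UNIV" "n > 0" "\<And>z. F z = (z - z0) ^ n * g z" "g z0 \<noteq> 0" by metis
  have "{z. g z = 0} = Z"
  proof -
    have "F z = 0 \<longleftrightarrow> z = z0 \<or> g z = 0" for z using g(2,3) by auto
    moreover have "F z = 0 \<longleftrightarrow> z = z0 \<or> z \<in> Z" for z using insert.prems(2) by auto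
    ultimately show ?thesis using g(4) insert.hyps(2) by (intro set_eqI) (metis mem_Collect_eq)
  qed
  from insert.IH[OF g(1) this] obtain P h R where
    h: "h holomorphic_on UNIV" "\<And>z. h z \<noteq> 0" "\<And>z. g z = P z * h z" "\<And>z. norm z \<ge> R \<Longrightarrow> norm (P z) \<ge> (1::real)"
    by blast
  show ?case
  proof (rule exI[of _ "\<lambda>z. (z - z0) ^ n * P z"], rule exI[of _ h], rule exI[of _ "max R (norm z0 + 1)"],
      intro conjI allI impI)
    fix z :: complex assume z: "norm z \<ge> max R (norm z0 + 1)"
    have "norm (z - z0) \<ge> 1" using z norm_triangle_ineq2[of z z0] by simp
    then have "1 * 1 \<le> norm (z - z0) ^ n * norm (P z)"
      using h(4)[of z] z by (intro mult_mono one_le_power) auto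
    then show "norm ((z - z0) ^ n * P z) \<ge> 1" by (simp add: norm_mult norm_power)
  qed (use g h in auto)
qed

text \<open>The zero-free factor exp G inherits the growth of F outside a disc and is bounded inside
  it. So Re G grows more slowly than linearly, G is constant, and |F| is at least |exp G| far
  out.\<close>

theorem entire_finite_zeros_bounded_below:
  fixes F :: "complex \<Rightarrow> complex"
  assumes F: "F holomorphic_on UNIV" and fin: "finite {z. F z = 0}"
    and rho: "0 \<le> \<rho>" "\<rho> < 1" and C: "C \<ge> 0" and B: "B \<ge> 0"
    and bound: "\<And>z. norm (F z) \<le> A * exp (B * (C + norm z) powr \<rho>)"
  shows "\<exists>d>0. \<exists>R. \<forall>z. norm z \<ge> R \<longrightarrow> norm (F z) \<ge> d"
proof -
  obtain P h R where h: "h holomorphic_on UNIV" "\<And>z. h z \<noteq> 0" and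
    P: "\<And>z. F z = P z * h z" "\<And>z. norm z \<ge> R \<Longrightarrow> norm (P z) \<ge> (1::real)"
    using entire_finite_zeros_factorization[OF fin F refl] by blast
  obtain G where G: "G holomorphic_on UNIV" "\<And>z. h z = exp (G z)"
    using contractible_imp_holomorphic_log[OF h(1) convex_imp_contractible[OF convex_UNIV]] h(2) by auto
  have "bounded (h ` cball 0 R)"
    by (intro compact_imp_bounded compact_continuous_image
        holomorphic_on_imp_continuous_on[OF holomorphic_on_subset[OF h(1)]]) auto
  then obtain M where M: "M > 0" "\<And>z. norm z \<le> R \<Longrightarrow> norm (h z) \<le> M"
    unfolding bounded_pos by auto
  \<comment> \<open>One constant for the inside and the outside of the disc; M > 0 makes its
    logarithm meaningful.\<close>
  define A' where "A' = max A M"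
  have A': "A' > 0" using M by (simp add: A'_def)
  have "G constant_on UNIV"
  proof (rule entire_Re_growth_imp_constant[OF G(1) rho C B])
    fix z :: complex
    let ?E = "B * (C + norm z) powr \<rho>"
    have E: "1 \<le> exp ?E" using B by simp
    have "norm (h z) \<le> A' * exp ?E"
    proof (cases "norm z \<ge> R")
      case True
      have "1 * norm (h z) \<le> norm (P z) * norm (h z)" by (intro mult_right_mono P(2) True) auto
      also have "\<dots> = norm (F z)" by (simp add: P(1) norm_mult)
      also have "\<dots> \<le> A * exp ?E" by (rule bound)
      also have "\<dots> \<le> A' * exp ?E" by (intro mult_right_mono) (auto simp: A'_def)
      finally show ?thesis by simp
    next
      case False
      then have "norm (h z) \<le> M * 1" using M(2)[of z] by simp
      also have "\<dots> \<le> A' * exp ?E" using E M by (intro mult_mono) (auto simp: A'_def)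
      finally show ?thesis .
    qed
    also have "\<dots> = exp (ln A' + ?E)" using A' by (simp add: exp_add)
    finally show "Re (G z) \<le> ln A' + ?E" by (simp add: G(2))
  qed
  then obtain c where c: "\<And>z. G z = c" by (auto simp: constant_on_def)
  show ?thesis
  proof (rule exI[of _ "norm (exp c)"], intro exI[of _ R] conjI allI impI)
    fix z :: complex assume "norm z \<ge> R"
    then have "1 * norm (exp c) \<le> norm (P z) * norm (exp c)" by (intro mult_right_mono P(2)) auto
    then show "norm (exp c) \<le> norm (F z)" by (simp add: P(1) G(2) c norm_mult)
  qed auto
qed

section \<open>Riemann-Liouville integrals\<close>

text \<open>The cutoff at 0 replaces integrals over [0, t] by convolutions on the whole line, so the
  semigroup law holds for all arguments. In particular \<open>rl_kernel 1\<close> is the indicator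
  of the positive half line.\<close>

definition rl_kernel :: "real \<Rightarrow> real \<Rightarrow> real" where
  "rl_kernel \<beta> x = (if 0 < x then x powr (\<beta> - 1) / Gamma \<beta> else 0)"

lemma rl_kernel_measurable [measurable]: "rl_kernel \<beta> \<in> borel_measurable borel"
  unfolding rl_kernel_def by measurable

lemma rl_kernel_nonneg: "\<beta> > 0 \<Longrightarrow> 0 \<le> rl_kernel \<beta> x"
  by (simp add: rl_kernel_def)

lemma rl_kernel_nonpos [simp]: "x \<le> 0 \<Longrightarrow> rl_kernel \<beta> x = 0"
  by (simp add: rl_kernel_def)

lemma rl_kernel_one: "rl_kernel 1 x = (if 0 < x then 1 else 0)"
  by (simp add: rl_kernel_def)

lemma rl_kernel_le: "\<beta> \<ge> 1 \<Longrightarrow> x \<le> 1 \<Longrightarrow> rl_kernel \<beta> x \<le> rGamma \<beta> * rl_kernel 1 x"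
  by (auto simp: rl_kernel_def rGamma_inverse_Gamma divide_inverse powr_le1 intro!: mult_left_le_one_le)

lemma rl_kernel_le_rGamma: "\<beta> \<ge> 1 \<Longrightarrow> x \<le> 1 \<Longrightarrow> rl_kernel \<beta> x \<le> rGamma \<beta>"
  using rl_kernel_le[of \<beta> x] by (auto simp: rl_kernel_one rGamma_inverse_Gamma split: if_splits)

text \<open>The substitution s = r + (t - r) u produces the Beta integral. The base point r is kept
  general because the semigroup law needs the inner integral between r and t.\<close>

lemma has_bochner_integral_rl_kernel_convolution:
  assumes a: "a > 0" and b: "b > 0"
  shows "has_bochner_integral lborel (\<lambda>s. rl_kernel a (t - s) * rl_kernel b (s - r)) (rl_kernel (a + b) (t - r))"
proof (cases "t > r")
  case False
  then have "(\<lambda>s. rl_kernel a (t - s) * rl_kernel b (s - r)) = (\<lambda>s. 0)"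
    by (auto simp: rl_kernel_def)
  then show ?thesis using False by (simp add: has_bochner_integral_zero)
next
  case True
  define l where "l = t - r"
  have l: "l > 0" using True by (simp add: l_def)
  have I: "((\<lambda>u. u powr (b - 1) * (1 - u) powr (a - 1)) has_integral Beta b a) {0..1}"
    by (rule has_integral_Beta_real[OF b a])
  then have "(\<lambda>u. u powr (b - 1) * (1 - u) powr (a - 1)) absolutely_integrable_on {0..1}"
    by (intro nonnegative_absolutely_integrable_1) auto
  then have i: "set_integrable lborel {0..1} (\<lambda>u. u powr (b - 1) * (1 - u) powr (a - 1))"
    unfolding set_integrable_def by (subst (asm) integrable_completion) auto
  have "has_bochner_integral lborel (\<lambda>u. indicator {0..1} u *\<^sub>R (u powr (b - 1) * (1 - u) powr (a - 1))) (Beta b a)"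
    using i set_borel_integral_eq_integral(2)[OF i] integral_unique[OF I]
    by (simp add: has_bochner_integral_iff set_integrable_def set_lebesgue_integral_def)
  from has_bochner_integral_mult_right[OF this, of "l powr (a + b - 2) / (Gamma a * Gamma b)"]
  have "has_bochner_integral lborel (\<lambda>u. l powr (a + b - 2) / (Gamma a * Gamma b) *
     (indicator {0..1} u *\<^sub>R (u powr (b - 1) * (1 - u) powr (a - 1)))) (l powr (a + b - 2) / (Gamma a * Gamma b) * Beta b a)"
    by simp
  moreover have "l powr (a + b - 2) / (Gamma a * Gamma b) *
     (indicator {0..1} u *\<^sub>R (u powr (b - 1) * (1 - u) powr (a - 1)))
     = rl_kernel a (t - (r + l * u)) * rl_kernel b ((r + l * u) - r)" for u
  proof (cases "0 < u \<and> u < 1")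
    case True
    have "t - (r + l * u) = l * (1 - u)" by (simp add: l_def algebra_simps)
    moreover have "l powr (a + b - 2) = l powr (a - 1) * l powr (b - 1)" by (simp flip: powr_add)
    ultimately show ?thesis using True l by (simp add: rl_kernel_def powr_mult)
  next
    case False
    \<comment> \<open>At u = 0 and u = 1 both sides agree as well: 0 powr anything is 0, and the
      kernel vanishes at 0.\<close>
    have "l * u \<le> 0 \<or> l * u \<ge> l"
      using False l by (auto simp: mult_le_0_iff not_less)
    moreover have "u powr (b - 1) * (1 - u) powr (a - 1) = 0 \<or> u \<notin> {0..1}" using False by auto
    ultimately have 0: "u powr (b - 1) * (1 - u) powr (a - 1) = 0 \<or> u \<notin> {0..1}"
        "(r + l * u) - r \<le> 0 \<or> t - (r + l * u) \<le> 0"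
      using l_def by linarith+
    then have "rl_kernel a (t - (r + l * u)) * rl_kernel b ((r + l * u) - r) = 0"
      by (metis mult_zero_left mult_zero_right rl_kernel_nonpos)
    with 0(1) show ?thesis by (metis indicator_simps(2) mult_zero_right scaleR_zero_left scaleR_zero_right)
  qed
  ultimately have "has_bochner_integral lborel (\<lambda>u. rl_kernel a (t - (r + l * u)) * rl_kernel b ((r + l * u) - r))
     (l powr (a + b - 2) / (Gamma a * Gamma b) * Beta b a)"
    by simp
  moreover have "l powr (a + b - 2) / (Gamma a * Gamma b) * Beta b a = rl_kernel (a + b) (t - r) /\<^sub>R \<bar>l\<bar>"
  proof -
    have "l powr (a + b - 2) = l powr (a + b - 1) / l" using l by (simp add: powr_diff power2_eq_square)
    moreover have "Gamma a \<noteq> 0" "Gamma b \<noteq> 0"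
      using less_imp_neq[OF Gamma_real_pos[OF a]] less_imp_neq[OF Gamma_real_pos[OF b]] by metis+
    ultimately show ?thesis using l
      by (simp add: rl_kernel_def Beta_def l_def[symmetric] add.commute[of b a] inverse_eq_divide)
  qed
  ultimately show ?thesis
    using lborel_has_bochner_integral_real_affine_iff[of l "\<lambda>s. rl_kernel a (t - s) * rl_kernel b (s - r)" _ r] l
    by auto
qed

lemma
  assumes "a > 0" "b > 0"
  shows integrable_rl_kernel_convolution: "integrable lborel (\<lambda>s. rl_kernel a (t - s) * rl_kernel b (s - r))"
    and integral_rl_kernel_convolution:
      "(LINT s|lborel. rl_kernel a (t - s) * rl_kernel b (s - r)) = rl_kernel (a + b) (t - r)"
  using has_bochner_integral_rl_kernel_convolution[OF assms] by (simp_all add: has_bochner_integral_iff)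

text \<open>For functions that vanish on the negative half line, the convolution with \<open>rl_kernel \<beta>\<close> over the
  whole line is the Riemann-Liouville integral.\<close>

definition frac_int :: "real \<Rightarrow> (real \<Rightarrow> complex) \<Rightarrow> real \<Rightarrow> complex" where
  "frac_int \<beta> f t = (LINT s|lborel. rl_kernel \<beta> (t - s) *\<^sub>R f s)"

text \<open>A multiple of \<open>rl_kernel 1\<close> as bound encodes two facts at once: f vanishes
  for s <= 0 and is bounded on (0, 1]. Nothing is asked of the size beyond 1, where fractional
  integrals at t <= 1 do not look. Being a kernel, the bound can be fed into further
  integrals.\<close>

definition admissible :: "(real \<Rightarrow> complex) \<Rightarrow> bool" where
  "admissible f \<longleftrightarrow> f \<in> borel_measurable borel \<and> (\<exists>A. \<forall>s\<le>1. norm (f s) \<le> A * rl_kernel 1 s)"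

lemma admissibleE:
  assumes "admissible f"
  obtains A where "A \<ge> 0" "f \<in> borel_measurable borel" "\<And>s. s \<le> 1 \<Longrightarrow> norm (f s) \<le> A * rl_kernel 1 s"
proof -
  from assms obtain A where A: "f \<in> borel_measurable borel" "\<And>s. s \<le> 1 \<Longrightarrow> norm (f s) \<le> A * rl_kernel 1 s"
    by (auto simp: admissible_def)
  moreover from A(2)[of 1] have "A \<ge> 0" by (simp add: rl_kernel_one) (meson norm_ge_zero order.trans)
  ultimately show thesis by (intro that)
qed

lemma admissible_measurable: "admissible f \<Longrightarrow> f \<in> borel_measurable borel"
  by (simp add: admissible_def)

lemma admissible_eq_0: "admissible f \<Longrightarrow> s \<le> 0 \<Longrightarrow> f s = 0"
  by (erule admissibleE) (metis norm_le_zero_iff mult_zero_right rl_kernel_nonpos order.trans zero_le_one)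

lemma frac_int_measurable [measurable]:
  assumes [measurable]: "f \<in> borel_measurable borel"
  shows "frac_int \<beta> f \<in> borel_measurable borel"
  unfolding frac_int_def by measurable

text \<open>Bounds by kernels propagate without loss: integration of order \<beta> raises the order
  of the majorant by \<beta> and keeps the constant. Iteration thus produces the Gamma denominators
  that make all series converge.\<close>

lemma
  assumes f[measurable]: "f \<in> borel_measurable borel" and c: "c > 0" and b: "\<beta> > 0"
    and bound: "\<And>s. s \<le> t \<Longrightarrow> norm (f s) \<le> A * rl_kernel c s"
  shows integrable_frac_int_bound: "integrable lborel (\<lambda>s. rl_kernel \<beta> (t - s) *\<^sub>R f s)"
    and norm_frac_int_le': "(LINT s|lborel. norm (rl_kernel \<beta> (t - s) *\<^sub>R f s)) \<le> A * rl_kernel (\<beta> + c) t"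
    and norm_frac_int_le: "norm (frac_int \<beta> f t) \<le> A * rl_kernel (\<beta> + c) t"
proof -
  note hbi = has_bochner_integral_mult_right[OF has_bochner_integral_rl_kernel_convolution[OF b c, of t 0], of A]
  have le: "norm (rl_kernel \<beta> (t - s) *\<^sub>R f s) \<le> A * (rl_kernel \<beta> (t - s) * rl_kernel c (s - 0))" for s
  proof (cases "s \<le> t")
    case True
    then have "rl_kernel \<beta> (t - s) * norm (f s) \<le> rl_kernel \<beta> (t - s) * (A * rl_kernel c s)"
      using bound b by (intro mult_left_mono rl_kernel_nonneg)
    then show ?thesis using rl_kernel_nonneg[OF b, of "t - s"] by (simp add: mult_ac)
  qed simp
  have I: "integrable lborel (\<lambda>s. A * (rl_kernel \<beta> (t - s) * rl_kernel c (s - 0)))"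
    using hbi by (simp add: has_bochner_integral_iff)
  show i: "integrable lborel (\<lambda>s. rl_kernel \<beta> (t - s) *\<^sub>R f s)"
  proof (rule Bochner_Integration.integrable_bound[OF I])
    show "AE s in lborel. norm (rl_kernel \<beta> (t - s) *\<^sub>R f s) \<le> norm (A * (rl_kernel \<beta> (t - s) * rl_kernel c (s - 0)))"
      unfolding real_norm_def by (intro AE_I2 order.trans[OF le abs_ge_self])
  qed measurable
  have "(LINT s|lborel. norm (rl_kernel \<beta> (t - s) *\<^sub>R f s)) \<le> (LINT s|lborel. A * (rl_kernel \<beta> (t - s) * rl_kernel c (s - 0)))"
    by (intro integral_mono integrable_norm i I le)
  also have "\<dots> = A * rl_kernel (\<beta> + c) t"
    using hbi by (simp add: has_bochner_integral_iff)
  finally show *: "(LINT s|lborel. norm (rl_kernel \<beta> (t - s) *\<^sub>R f s)) \<le> A * rl_kernel (\<beta> + c) t" .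
  show "norm (frac_int \<beta> f t) \<le> A * rl_kernel (\<beta> + c) t"
    unfolding frac_int_def by (rule order.trans[OF integral_norm_bound *])
qed

lemma integrable_frac_int:
  assumes "admissible f" "\<beta> > 0" "t \<le> 1"
  shows "integrable lborel (\<lambda>s. rl_kernel \<beta> (t - s) *\<^sub>R f s)"
  using assms(1)
proof (rule admissibleE)
  fix A assume "f \<in> borel_measurable borel" "\<And>s. s \<le> 1 \<Longrightarrow> norm (f s) \<le> A * rl_kernel 1 s"
  then show ?thesis using assms by (intro integrable_frac_int_bound[where c = 1 and A = A]) auto
qed

lemma admissible_of_bound:
  assumes "f \<in> borel_measurable borel" "c \<ge> 1" "\<And>s. s \<le> 1 \<Longrightarrow> norm (f s) \<le> A * rl_kernel c s"
  shows "admissible f"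
  unfolding admissible_def
proof (intro conjI exI allI impI)
  fix s :: real assume s: "s \<le> 1"
  have "A * rl_kernel c s \<le> \<bar>A\<bar> * (rGamma c * rl_kernel 1 s)"
    using assms(2) s by (intro mult_mono rl_kernel_le rl_kernel_nonneg) auto
  with assms(3)[OF s] show "norm (f s) \<le> (\<bar>A\<bar> * rGamma c) * rl_kernel 1 s" by (simp add: mult.assoc)
qed fact

lemma admissible_rl_kernel: "\<beta> \<ge> 1 \<Longrightarrow> admissible (\<lambda>t. of_real (rl_kernel \<beta> t))"
  by (rule admissible_of_bound[where c = \<beta> and A = 1]) (auto simp: rl_kernel_nonneg)

lemma admissible_frac_int:
  assumes f: "admissible f" and b: "\<beta> > 0"
  shows "admissible (frac_int \<beta> f)"
  using f
proof (rule admissibleE)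
  fix A assume A: "A \<ge> 0" "f \<in> borel_measurable borel" "\<And>s. s \<le> 1 \<Longrightarrow> norm (f s) \<le> A * rl_kernel 1 s"
  show ?thesis
  proof (rule admissible_of_bound[where c = "\<beta> + 1" and A = A])
    show "norm (frac_int \<beta> f s) \<le> A * rl_kernel (\<beta> + 1) s" if "s \<le> 1" for s
      using A that b by (intro norm_frac_int_le) auto
  qed (use A b in auto)
qed

lemma admissible_add: "admissible f \<Longrightarrow> admissible g \<Longrightarrow> admissible (\<lambda>s. f s + g s)"
proof (elim admissibleE)
  fix A B assume *: "f \<in> borel_measurable borel" "\<And>s. s \<le> 1 \<Longrightarrow> norm (f s) \<le> A * rl_kernel 1 s"
    "g \<in> borel_measurable borel" "\<And>s. s \<le> 1 \<Longrightarrow> norm (g s) \<le> B * rl_kernel 1 s"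
  show ?thesis
    by (rule admissible_of_bound[where c = 1 and A = "A + B"])
      (use * in \<open>auto simp: distrib_right intro!: norm_triangle_mono\<close>)
qed

lemma admissible_mult_bounded:
  assumes m: "m \<in> borel_measurable borel" "\<And>s. norm (m s) \<le> C" and f: "admissible f"
  shows "admissible (\<lambda>s. m s * f s)"
  using f
proof (rule admissibleE)
  fix A assume A: "A \<ge> 0" "f \<in> borel_measurable borel" "\<And>s. s \<le> 1 \<Longrightarrow> norm (f s) \<le> A * rl_kernel 1 s"
  show ?thesis
  proof (rule admissible_of_bound[where c = 1 and A = "C * A"])
    show "norm (m s * f s) \<le> C * A * rl_kernel 1 s" if "s \<le> 1" for s
      unfolding norm_mult mult.assoc using order.trans[OF norm_ge_zero m(2)] A that m
      by (intro mult_mono) auto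
  qed (use A m in auto)
qed

lemma admissible_cmult: "admissible f \<Longrightarrow> admissible (\<lambda>s. c * f s)"
  by (rule admissible_mult_bounded[of "\<lambda>_. c" "norm c"]) auto

lemma admissible_uminus: "admissible f \<Longrightarrow> admissible (\<lambda>s. - f s)"
  using admissible_cmult[of f "-1"] by simp

lemma admissible_zero: "admissible (\<lambda>_. 0)"
  by (rule admissible_of_bound[where c = 1 and A = 0]) auto

lemma admissible_sum: "(\<And>i. i \<in> I \<Longrightarrow> admissible (f i)) \<Longrightarrow> admissible (\<lambda>s. \<Sum>i\<in>I. f i s)"
  by (induction I rule: infinite_finite_induct) (auto intro!: admissible_add admissible_zero)

lemma frac_int_cong: "(\<And>s. s < t \<Longrightarrow> f s = g s) \<Longrightarrow> frac_int \<beta> f t = frac_int \<beta> g t"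
  unfolding frac_int_def by (intro Bochner_Integration.integral_cong refl) (metis diff_le_0_iff_le not_less rl_kernel_nonpos scale_zero_left)

lemma frac_int_add:
  assumes "admissible f" "admissible g" "\<beta> > 0" "t \<le> 1"
  shows "frac_int \<beta> (\<lambda>s. f s + g s) t = frac_int \<beta> f t + frac_int \<beta> g t"
  unfolding frac_int_def scaleR_add_right
  by (intro Bochner_Integration.integral_add integrable_frac_int assms)

lemma frac_int_cmult: "frac_int \<beta> (\<lambda>s. c * f s) t = c * frac_int \<beta> f t"
  unfolding frac_int_def by (simp flip: integral_mult_right_zero add: mult_scaleR_right)

lemma frac_int_uminus: "frac_int \<beta> (\<lambda>s. - f s) t = - frac_int \<beta> f t"
  using frac_int_cmult[of \<beta> "-1"] by simp

lemma frac_int_zero [simp]: "frac_int \<beta> (\<lambda>_. 0) t = 0"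
  by (simp add: frac_int_def)

lemma frac_int_sum:
  assumes "\<And>i. i \<in> I \<Longrightarrow> admissible (f i)" "\<beta> > 0" "t \<le> 1"
  shows "frac_int \<beta> (\<lambda>s. \<Sum>i\<in>I. f i s) t = (\<Sum>i\<in>I. frac_int \<beta> (f i) t)"
  using assms by (induction I rule: infinite_finite_induct) (auto simp: frac_int_add admissible_sum)

lemma frac_int_rl_kernel:
  assumes "a > 0" "b > 0"
  shows "frac_int a (\<lambda>t. of_real (rl_kernel b t)) t = of_real (rl_kernel (a + b) t)"
  using integral_rl_kernel_convolution[OF assms, of t 0]
  unfolding frac_int_def by (simp add: scaleR_conv_of_real flip: of_real_mult)

text \<open>Fubini and the convolution law of the kernels; the absolute integrability needed for
  Fubini comes from the kernel majorant of the inner integral.\<close>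

lemma frac_int_semigroup:
  assumes f: "admissible f" and a: "a > 0" and b: "b > 0" and t: "t \<le> 1"
  shows "frac_int a (frac_int b f) t = frac_int (a + b) f t"
  using f
proof (rule admissibleE)
  fix A assume A: "A \<ge> 0" and f[measurable]: "f \<in> borel_measurable borel"
    and le: "\<And>s. s \<le> 1 \<Longrightarrow> norm (f s) \<le> A * rl_kernel 1 s"
  let ?h = "\<lambda>(s, r). rl_kernel a (t - s) *\<^sub>R (rl_kernel b (s - r) *\<^sub>R f r)"
  have inner: "integrable lborel (\<lambda>r. rl_kernel b (s - r) *\<^sub>R f r)"
      "(LINT r|lborel. norm (rl_kernel b (s - r) *\<^sub>R f r)) \<le> A * rl_kernel (b + 1) s" if "s \<le> t" for s
    using le that t b by (auto intro!: integrable_frac_int_bound[where c = 1 and A = A] norm_frac_int_le'[where c = 1] simp del: norm_scaleR)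
  have "integrable (lborel \<Otimes>\<^sub>M lborel) ?h"
  proof (rule lborel_pair.Fubini_integrable)
    have "?h \<in> borel_measurable (borel \<Otimes>\<^sub>M borel)" by measurable
    then show "?h \<in> borel_measurable (lborel \<Otimes>\<^sub>M lborel)"
      by (simp cong: measurable_cong_sets)
    show "AE s in lborel. integrable lborel (\<lambda>r. ?h (s, r))"
    proof (rule AE_I2)
      fix s show "integrable lborel (\<lambda>r. ?h (s, r))"
        using inner(1)[of s] by (cases "s \<le> t") (simp_all del: scaleR_scaleR)
    qed
    have I: "integrable lborel (\<lambda>s. A * (rl_kernel a (t - s) * rl_kernel (b + 1) (s - 0)))"
      using a b by (intro integrable_mult_right integrable_rl_kernel_convolution) auto
    show "integrable lborel (\<lambda>s. LINT r|lborel. norm (?h (s, r)))"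
    proof (rule Bochner_Integration.integrable_bound[OF I])
      show "AE s in lborel. norm (LINT r|lborel. norm (?h (s, r))) \<le> norm (A * (rl_kernel a (t - s) * rl_kernel (b + 1) (s - 0)))"
      proof (rule AE_I2)
        fix s
        show "norm (LINT r|lborel. norm (?h (s, r))) \<le> norm (A * (rl_kernel a (t - s) * rl_kernel (b + 1) (s - 0)))"
        proof (cases "s \<le> t")
          case True
          have "(LINT r|lborel. norm (?h (s, r))) = rl_kernel a (t - s) * (LINT r|lborel. norm (rl_kernel b (s - r) *\<^sub>R f r))"
            unfolding prod.case norm_scaleR[of "rl_kernel a (t - s)"] abs_of_nonneg[OF rl_kernel_nonneg[OF a]]
            by (rule integral_mult_right_zero)
          also have "\<dots> \<le> rl_kernel a (t - s) * (A * rl_kernel (b + 1) s)"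
            by (intro mult_left_mono inner(2) True rl_kernel_nonneg a)
          finally show ?thesis using A a b
            by (simp add: rl_kernel_nonneg integral_nonneg_AE mult_ac)
        qed simp
      qed
    qed measurable
  qed
  from lborel_pair.Fubini_integral[OF this]
  have "(LINT r|lborel. LINT s|lborel. ?h (s, r)) = (LINT s|lborel. LINT r|lborel. ?h (s, r))"
    unfolding prod.case .
  moreover have "(LINT s|lborel. LINT r|lborel. ?h (s, r)) = frac_int a (frac_int b f) t"
    unfolding frac_int_def by (simp del: scaleR_scaleR)
  moreover have "(LINT s|lborel. ?h (s, r)) = rl_kernel (a + b) (t - r) *\<^sub>R f r" for r
  proof -
    have "(LINT s|lborel. ?h (s, r)) = (LINT s|lborel. (rl_kernel a (t - s) * rl_kernel b (s - r)) *\<^sub>R f r)"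
      by simp
    also have "\<dots> = (LINT s|lborel. rl_kernel a (t - s) * rl_kernel b (s - r)) *\<^sub>R f r"
      using integrable_rl_kernel_convolution[OF a b] by (intro integral_scaleR_left) auto
    finally show ?thesis by (simp add: integral_rl_kernel_convolution[OF a b])
  qed
  ultimately show ?thesis unfolding frac_int_def by simp
qed

lemma
  assumes meas: "\<And>n. f n \<in> borel_measurable borel" and b: "\<beta> > 0"
    and le: "\<And>n s. s \<le> 1 \<Longrightarrow> norm (f n s) \<le> B n * rl_kernel 1 s" and B: "summable B"
  shows admissible_suminf: "admissible (\<lambda>s. \<Sum>n. f n s)"
    and frac_int_suminf: "t \<le> 1 \<Longrightarrow> (\<lambda>n. frac_int \<beta> (f n) t) sums frac_int \<beta> (\<lambda>s. \<Sum>n. f n s) t"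
proof -
  note meas[measurable]
  have B0: "B n \<ge> 0" for n
    using le[of 1 n] by (simp add: rl_kernel_one) (meson norm_ge_zero order.trans)
  have summ: "summable (\<lambda>n. norm (f n s))" if "s \<le> 1" for s
    using le[OF that] B by (intro summable_comparison_test[OF _ summable_mult2[OF B]]) auto
  show "admissible (\<lambda>s. \<Sum>n. f n s)"
  proof (rule admissible_of_bound[where c = 1 and A = "suminf B"])
    show "norm (\<Sum>n. f n s) \<le> suminf B * rl_kernel 1 s" if "s \<le> 1" for s
    proof -
      have "norm (\<Sum>n. f n s) \<le> (\<Sum>n. norm (f n s))" by (rule summable_norm[OF summ[OF that]])
      also have "\<dots> \<le> (\<Sum>n. B n * rl_kernel 1 s)"
        by (intro suminf_le le that summ summable_mult2 B)
      finally show ?thesis by (simp add: suminf_mult2[OF B])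
    qed
  qed auto
  assume t: "t \<le> 1"
  have "(\<lambda>n. LINT s|lborel. rl_kernel \<beta> (t - s) *\<^sub>R f n s) sums (LINT s|lborel. (\<Sum>n. rl_kernel \<beta> (t - s) *\<^sub>R f n s))"
  proof (rule sums_integral)
    show "integrable lborel (\<lambda>s. rl_kernel \<beta> (t - s) *\<^sub>R f n s)" for n
      using le t b by (intro integrable_frac_int_bound[where c = 1 and A = "B n"]) auto
    show "AE s in lborel. summable (\<lambda>n. norm (rl_kernel \<beta> (t - s) *\<^sub>R f n s))"
    proof (rule AE_I2)
      fix s show "summable (\<lambda>n. norm (rl_kernel \<beta> (t - s) *\<^sub>R f n s))"
        using summ[of s] t by (cases "s \<le> t") (auto intro: summable_mult)
    qed
    show "summable (\<lambda>n. LINT s|lborel. norm (rl_kernel \<beta> (t - s) *\<^sub>R f n s))"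
    proof (rule summable_comparison_test[OF _ summable_mult2[OF B, of "rl_kernel (\<beta> + 1) t"]], intro exI allI impI)
      fix n
      have "(LINT s|lborel. norm (rl_kernel \<beta> (t - s) *\<^sub>R f n s)) \<le> B n * rl_kernel (\<beta> + 1) t"
        using le t b by (intro norm_frac_int_le') auto
      then show "norm (LINT s|lborel. norm (rl_kernel \<beta> (t - s) *\<^sub>R f n s)) \<le> B n * rl_kernel (\<beta> + 1) t"
        by (simp add: integral_nonneg_AE)
    qed
  qed
  moreover have "(\<Sum>n. rl_kernel \<beta> (t - s) *\<^sub>R f n s) = rl_kernel \<beta> (t - s) *\<^sub>R (\<Sum>n. f n s)" for s
    using summable_norm_cancel[OF summ[of s]] t by (cases "s \<le> t") (auto simp: suminf_scaleR_right)
  ultimately show "(\<lambda>n. frac_int \<beta> (f n) t) sums frac_int \<beta> (\<lambda>s. \<Sum>n. f n s) t"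
    unfolding frac_int_def by simp
qed

lemma continuous_on_rl_kernel:
  assumes "\<beta> > 1"
  shows "continuous_on UNIV (rl_kernel \<beta>)"
proof -
  have "rl_kernel \<beta> = (\<lambda>x. max 0 x powr (\<beta> - 1) / Gamma \<beta>)"
    using assms by (auto simp: rl_kernel_def max_def)
  moreover have "Gamma \<beta> > 0" using assms by (intro Gamma_real_pos) simp
  then have "continuous_on UNIV (\<lambda>x::real. max 0 x powr (\<beta> - 1) / Gamma \<beta>)"
    using assms less_imp_neq[OF \<open>Gamma \<beta> > 0\<close>]
    by (intro continuous_on_divide continuous_on_powr' continuous_on_max continuous_on_const continuous_on_id) auto
  ultimately show ?thesis by simp
qed

text \<open>For \<beta> > 1 the kernel itself is continuous, so dominated convergence suffices
  although f is only bounded and measurable.\<close>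

lemma continuous_on_frac_int:
  assumes f: "admissible f" and b: "\<beta> > 1"
  shows "continuous_on {..1} (frac_int \<beta> f)"
  using f
proof (rule admissibleE)
  fix A assume A: "A \<ge> 0" and f[measurable]: "f \<in> borel_measurable borel"
    and le: "\<And>s. s \<le> 1 \<Longrightarrow> norm (f s) \<le> A * rl_kernel 1 s"
  show ?thesis
  proof (rule continuous_on_sequentiallyI)
    fix u :: "nat \<Rightarrow> real" and t :: real assume u: "\<forall>n. u n \<in> {..1}" "t \<in> {..1}" "u \<longlonglongrightarrow> t"
    show "(\<lambda>n. frac_int \<beta> f (u n)) \<longlonglongrightarrow> frac_int \<beta> f t"
      unfolding frac_int_def
    proof (rule integral_dominated_convergence[where w = "\<lambda>s. indicator {0..1} s * (rGamma \<beta> * A)"])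
      show "AE s in lborel. (\<lambda>n. rl_kernel \<beta> (u n - s) *\<^sub>R f s) \<longlonglongrightarrow> rl_kernel \<beta> (t - s) *\<^sub>R f s"
        using u(3) by (intro AE_I2 tendsto_intros continuous_on_tendsto_compose[OF continuous_on_rl_kernel[OF b]]) auto
      show "AE s in lborel. norm (rl_kernel \<beta> (u n - s) *\<^sub>R f s) \<le> indicator {0..1} s * (rGamma \<beta> * A)" for n
      proof (rule AE_I2)
        fix s
        consider "s \<le> 0" | "s \<ge> u n" | "0 < s" "s < u n" by linarith
        then show "norm (rl_kernel \<beta> (u n - s) *\<^sub>R f s) \<le> indicator {0..1} s * (rGamma \<beta> * A)"
        proof cases
          case 1 then show ?thesis using admissible_eq_0[OF assms(1), of s] A b by (simp add: rGamma_inverse_Gamma indicator_def)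
        next
          case 2 then show ?thesis using A b by (simp add: rGamma_inverse_Gamma indicator_def)
        next
          case 3
          have "u n \<le> 1" using u(1) by auto
          then have "rl_kernel \<beta> (u n - s) * norm (f s) \<le> rGamma \<beta> * A"
            using 3 b A le[of s] by (intro mult_mono rl_kernel_le_rGamma) (auto simp: rGamma_inverse_Gamma rl_kernel_one)
          then show ?thesis using 3 \<open>u n \<le> 1\<close> b by (simp add: rl_kernel_nonneg)
        qed
      qed
    qed auto
  qed
qed

section \<open>Mittag-Leffler series\<close>

text \<open>Log-convexity of Gamma: 1 + n lies between 1 and 1 + a n with weight 1 / a on the
  latter, and ln (Gamma 1) = 0.\<close>

lemma fact_powr_le_Gamma:
  assumes "a \<ge> 1"
  shows "fact n powr a \<le> Gamma (1 + a * real n)"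
proof -
  have conv: "(ln \<circ> Gamma) ((1 - 1 / a) *\<^sub>R 1 + (1 / a) *\<^sub>R (1 + a * real n))
     \<le> (1 - 1 / a) * (ln \<circ> Gamma) 1 + (1 / a) * (ln \<circ> Gamma) (1 + a * real n)"
    using assms by (intro convex_onD[OF log_convex_Gamma_real]) (auto intro: add_pos_nonneg)
  have "(1 - 1 / a) *\<^sub>R 1 + (1 / a) *\<^sub>R (1 + a * real n) = 1 + real n"
    using assms by (simp add: field_simps)
  from conv[unfolded this] have "ln (fact n) \<le> (1 / a) * ln (Gamma (1 + a * real n))"
    by (simp add: Gamma_fact)
  then have "a * ln (fact n) \<le> ln (Gamma (1 + a * real n))" using assms by (simp add: field_simps)
  then have "exp (a * ln (fact n)) \<le> exp (ln (Gamma (1 + a * real n)))" by simp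
  moreover have "Gamma (1 + a * real n) > 0" using assms by (intro Gamma_real_pos) (simp add: add_pos_nonneg)
  ultimately show ?thesis by (simp add: powr_def)
qed

text \<open>With \<open>t n = x powr (n / a) / n!\<close> the left-hand side is at most \<open>\<Sum>n. t n powr a \<le> (\<Sum>n. t n) powr a\<close>.\<close>

lemma suminf_power_rGamma_le:
  assumes a: "a > 1" and x: "x \<ge> 0"
  shows "(\<Sum>n. x ^ n * rGamma (2 + a * real n)) \<le> exp (a * x powr (1 / a))"
proof (cases "x = 0")
  case True
  have "(\<Sum>n. x ^ n * rGamma (2 + a * real n)) = (\<Sum>n\<in>{0}. x ^ n * rGamma (2 + a * real n))"
    by (rule suminf_finite) (auto simp: True)
  also have "\<dots> = 1" using Gamma_fact[of 1, where 'a = real] by (simp add: rGamma_inverse_Gamma)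
  finally show ?thesis by (simp add: True)
next
  case False
  with x have x: "x > 0" by simp
  define w where "w = x powr (1 / a)"
  have w: "w > 0" using x by (simp add: w_def)
  have expw: "(\<lambda>n. w ^ n / fact n) sums exp w"
    using exp_converges[of w] by (simp add: scaleR_conv_of_real divide_inverse mult.commute)
  have le: "x ^ n * rGamma (2 + a * real n) \<le> exp w powr (a - 1) * (w ^ n / fact n)" for n
  proof -
    have pos: "1 + a * real n > 0" using a by (simp add: add_pos_nonneg)
    have "fact n powr a \<le> Gamma (1 + a * real n)" using a by (intro fact_powr_le_Gamma) simp
    \<comment> \<open>Passes from the argument 1 + a n to 2 + a n; the factor 1 + a n >= 1 only
      helps.\<close>
    also have "\<dots> \<le> (1 + a * real n) * Gamma (1 + a * real n)"
      using a pos mult_right_mono[of 1 "1 + a * real n" "Gamma (1 + a * real n)"] Gamma_real_pos[OF pos] by simp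
    also have "\<dots> = Gamma (2 + a * real n)"
      using Gamma_plus1[of "1 + a * real n"] pos by (simp add: add_ac nonpos_Ints_def)
    finally have G: "fact n powr a \<le> Gamma (2 + a * real n)" .
    have t: "w ^ n / fact n \<le> exp w"
      using sum_le_suminf[of "\<lambda>n. w ^ n / fact n" "{n}"] expw w by (auto simp: sums_iff)
    have "x ^ n = (w ^ n) powr a"
    proof -
      have "(w ^ n) powr a = w powr (real n * a)" using w by (simp add: powr_realpow[symmetric] powr_powr)
      also have "\<dots> = x powr real n" using a x by (simp add: w_def powr_powr)
      finally show ?thesis using x by (simp add: powr_realpow)
    qed
    then have "x ^ n * rGamma (2 + a * real n) = (w ^ n) powr a * inverse (Gamma (2 + a * real n))"
      by (simp add: rGamma_inverse_Gamma)
    also have "\<dots> \<le> (w ^ n) powr a * inverse (fact n powr a)"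
      using G by (intro mult_left_mono le_imp_inverse_le) auto
    also have "\<dots> = (w ^ n / fact n) powr a" using w by (subst powr_divide) (auto simp only: divide_inverse zero_le_power less_imp_le fact_ge_zero)
    also have "\<dots> = (w ^ n / fact n) powr (a - 1) * (w ^ n / fact n)"
      using w by (simp add: powr_diff)
    also have "\<dots> \<le> exp w powr (a - 1) * (w ^ n / fact n)"
      using t w a by (intro mult_right_mono powr_mono2) auto
    finally show ?thesis .
  qed
  have "summable (\<lambda>n. x ^ n * rGamma (2 + a * real n))"
    using summable_norm_cancel[OF summable_power_rGamma[OF a, of x 2]] by simp
  then have "(\<Sum>n. x ^ n * rGamma (2 + a * real n)) \<le> (\<Sum>n. exp w powr (a - 1) * (w ^ n / fact n))"
    using expw by (intro suminf_le le summable_mult) (auto simp: sums_iff)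
  also have "\<dots> = exp w powr (a - 1) * exp w"
    using expw by (subst suminf_mult) (auto simp: sums_iff)
  also have "\<dots> = exp w powr a" by (simp add: powr_diff)
  also have "\<dots> = exp (a * w)" by (simp add: powr_def)
  finally show ?thesis unfolding w_def .
qed

text \<open>For x > 0 the series is x powr (b - 1) times the Mittag-Leffler series at - l x powr a.
  Decay of order c in l is paid for by lowering the order of the kernel by a c, and d > 0 keeps the
  result integrable.\<close>

lemma Mittag_Leffler_kernel_bound:
  fixes a b c :: real
  assumes a: "1 < a" "a < 2" and c: "0 < c" "c < 1" and d: "0 < b - a * c"
  shows "\<exists>M\<ge>0. \<forall>l>0. \<forall>x. \<bar>\<Sum>n. (- l) ^ n * rl_kernel (b + a * real n) x\<bar> \<le> M * l powr (- c) * rl_kernel (b - a * c) x"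
proof -
  obtain M where M: "M \<ge> 0" "\<And>z. z > 0 \<Longrightarrow> \<bar>\<Sum>n. (- z) ^ n * rGamma (b + a * real n)\<bar> \<le> M * z powr (- c)"
    using Mittag_Leffler_bound[OF a c] by blast
  have "\<bar>\<Sum>n. (- l) ^ n * rl_kernel (b + a * real n) x\<bar> \<le> (M * Gamma (b - a * c)) * l powr (- c) * rl_kernel (b - a * c) x"
    if l: "l > 0" for l x
  proof (cases "x > 0")
    case True
    have "(- l) ^ n * rl_kernel (b + a * real n) x = x powr (b - 1) * ((- (l * x powr a)) ^ n * rGamma (b + a * real n))" for n
    proof -
      have "x powr (b + a * real n - 1) = x powr (b - 1) * (x powr a) ^ n"
        using True by (simp add: powr_add[symmetric] powr_realpow[symmetric] powr_powr algebra_simps)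
      then show ?thesis using True
        by (simp add: rl_kernel_def rGamma_inverse_Gamma divide_inverse power_mult_distrib power_minus[of "l * _"] power_minus[of l])
    qed
    then have "(\<Sum>n. (- l) ^ n * rl_kernel (b + a * real n) x)
        = x powr (b - 1) * (\<Sum>n. (- (l * x powr a)) ^ n * rGamma (b + a * real n))"
      using summable_norm_cancel[OF summable_power_rGamma[OF a(1), of "- (l * x powr a)" b]]
      by (simp add: suminf_mult)
    then have "\<bar>\<Sum>n. (- l) ^ n * rl_kernel (b + a * real n) x\<bar>
        = x powr (b - 1) * \<bar>\<Sum>n. (- (l * x powr a)) ^ n * rGamma (b + a * real n)\<bar>"
      by (simp add: abs_mult)
    also have "\<dots> \<le> x powr (b - 1) * (M * (l * x powr a) powr (- c))"
      using l True by (intro mult_left_mono M) auto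
    also have "\<dots> = M * l powr (- c) * x powr (b - a * c - 1)"
    proof -
      have "x powr (b - 1) * (x powr a) powr (- c) = x powr (b - a * c - 1)"
        by (simp add: powr_powr algebra_simps flip: powr_add)
      moreover have "(l * x powr a) powr (- c) = l powr (- c) * (x powr a) powr (- c)"
        using l True by (simp add: powr_mult)
      ultimately show ?thesis by (simp only: mult_ac)
    qed
    also have "\<dots> = (M * Gamma (b - a * c)) * l powr (- c) * rl_kernel (b - a * c) x"
      using True less_imp_neq[OF Gamma_real_pos[OF d]] by (simp add: rl_kernel_def)
    finally show ?thesis .
  qed simp
  moreover have "M * Gamma (b - a * c) \<ge> 0" using M d by simp
  ultimately show ?thesis by blast
qed

section \<open>Series of kernels and of fractional integrals\<close>

lemma rl_kernel_one_right: "rl_kernel b 1 = rGamma b"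
  by (simp add: rl_kernel_def rGamma_inverse_Gamma divide_inverse)

text \<open>The index \<open>Suc n\<close> keeps the order positive also for b = 0, the case in
  which the solution itself is expanded.\<close>

lemma abs_summable_frac_int_series:
  assumes a: "a > 1" and b: "b \<ge> 0" and f: "admissible f" and t: "t \<le> 1"
  shows "summable (\<lambda>n. norm (of_real z ^ n * frac_int (b + a * real (Suc n)) f t))"
  using f
proof (rule admissibleE)
  fix A assume A: "A \<ge> 0" "f \<in> borel_measurable borel" "\<And>s. s \<le> 1 \<Longrightarrow> norm (f s) \<le> A * rl_kernel 1 s"
  show ?thesis
  proof (rule summable_comparison_test[OF _ summable_mult[OF summable_power_rGamma[OF a, of z "b + a + 1"], of A]],
      intro exI allI impI)
    fix n
    have p: "0 < b + a * real (Suc n)" using a b by (simp add: add_nonneg_pos)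
    have "norm (frac_int (b + a * real (Suc n)) f t) \<le> A * rl_kernel (b + a * real (Suc n) + 1) t"
      using A t p by (intro norm_frac_int_le) auto
    also have "\<dots> \<le> A * rGamma (b + a * real (Suc n) + 1)"
      using A t p by (intro mult_left_mono rl_kernel_le_rGamma) auto
    finally have "norm (frac_int (b + a * real (Suc n)) f t) \<le> A * rGamma (b + a + 1 + a * real n)"
      by (simp add: algebra_simps)
    moreover have "Gamma (b + a + 1 + a * real n) > 0" using a b by (intro Gamma_real_pos add_pos_nonneg[of "b + a + 1"]) auto
    then have "rGamma (b + a + 1 + a * real n) \<ge> 0" by (simp add: rGamma_inverse_Gamma)
    moreover have "\<bar>z\<bar> ^ n * norm (frac_int (b + a * real (Suc n)) f t) \<le> \<bar>z\<bar> ^ n * (A * rGamma (b + a + 1 + a * real n))"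
      if "norm (frac_int (b + a * real (Suc n)) f t) \<le> A * rGamma (b + a + 1 + a * real n)"
      using that by (rule mult_left_mono) simp
    ultimately show "norm (norm (of_real z ^ n * frac_int (b + a * real (Suc n)) f t)) \<le>
        A * norm (z ^ n * of_real (rGamma (b + a + 1 + a * real n)))"
      by (simp add: norm_mult norm_power abs_mult power_abs mult_ac del: of_nat_Suc)
  qed
qed

lemma summable_rl_kernel_series:
  fixes a b x z :: real
  assumes a: "a > 1" and b: "b \<ge> 1" and x: "x \<le> 1"
  shows "summable (\<lambda>n. norm (z ^ n * rl_kernel (b + a * real n) x))"
proof (rule summable_comparison_test[OF _ summable_power_rGamma[OF a, of z b]], intro exI allI impI)
  fix n
  have bn: "b + a * real n \<ge> 1" using a b by (simp add: add_increasing2)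
  show "norm (norm (z ^ n * rl_kernel (b + a * real n) x)) \<le> norm (z ^ n * of_real (rGamma (b + a * real n)))"
    using rl_kernel_le_rGamma[OF bn x] bn
    by (auto simp: abs_mult rl_kernel_nonneg rGamma_inverse_Gamma intro!: mult_left_mono)
qed

text \<open>The cancellation sits in the kernel series and is lost if norms are taken term by term.
  So the sum is moved inside the integral, absolute convergence serving only to justify the
  exchange, and then the bound D for the summed kernel is used.\<close>

lemma frac_int_series_bound:
  assumes a: "a > 1" and b: "b \<ge> 1" and d: "d > 0" and f: "f \<in> borel_measurable borel" and t: "t \<le> 1"
    and A: "\<And>s. s \<le> 1 \<Longrightarrow> norm (f s) \<le> A * rl_kernel 1 s"
    and D: "\<And>x. x \<le> 1 \<Longrightarrow> \<bar>\<Sum>n. z ^ n * rl_kernel (b + a * real n) x\<bar> \<le> D * rl_kernel d x"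
  shows "norm (\<Sum>n. of_real z ^ n * frac_int (b + a * real n) f t) \<le> D * A * rl_kernel (d + 1) t"
proof -
  note f[measurable]
  define F where "F n s = (z ^ n * rl_kernel (b + a * real n) (t - s)) *\<^sub>R f s" for n s
  have A0: "A \<ge> 0" using A[of 1] by (simp add: rl_kernel_one) (meson norm_ge_zero order.trans)
  have f0: "f s = 0" if "s \<le> 0" for s using A[of s] that by simp
  have fA: "norm (f s) \<le> A" if "s \<le> 1" for s
    using A[OF that] A0 by (auto simp: rl_kernel_one split: if_splits)
  have bn: "b + a * real n \<ge> 1" for n using a b by (simp add: add_increasing2)
  have int: "integrable lborel (F n)" "integral\<^sup>L lborel (F n) = of_real z ^ n * frac_int (b + a * real n) f t"
     "(LINT s|lborel. norm (F n s)) \<le> norm (z ^ n * of_real (rGamma (b + 1 + a * real n))) * A" for n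
  proof -
    have Fn: "F n = (\<lambda>s. z ^ n *\<^sub>R (rl_kernel (b + a * real n) (t - s) *\<^sub>R f s))"
      by (simp add: F_def fun_eq_iff)
    have i: "integrable lborel (\<lambda>s. rl_kernel (b + a * real n) (t - s) *\<^sub>R f s)"
      using A bn[of n] t by (intro integrable_frac_int_bound[where c = 1 and A = A]) auto
    then show "integrable lborel (F n)" unfolding Fn by (rule integrable_scaleR_right)
    show "integral\<^sup>L lborel (F n) = of_real z ^ n * frac_int (b + a * real n) f t"
      unfolding Fn frac_int_def integral_scaleR_right by (simp add: scaleR_conv_of_real)
    have "(LINT s|lborel. norm (F n s)) = \<bar>z ^ n\<bar> * (LINT s|lborel. norm (rl_kernel (b + a * real n) (t - s) *\<^sub>R f s))"
      unfolding Fn norm_scaleR[of "z ^ n"] by (rule integral_mult_right_zero)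
    also have "\<dots> \<le> \<bar>z ^ n\<bar> * (A * rl_kernel (b + a * real n + 1) t)"
      using A bn[of n] t by (intro mult_left_mono norm_frac_int_le') auto
    also have "\<dots> \<le> \<bar>z ^ n\<bar> * (A * rGamma (b + a * real n + 1))"
      using A0 bn[of n] t by (intro mult_left_mono rl_kernel_le_rGamma) auto
    finally show "(LINT s|lborel. norm (F n s)) \<le> norm (z ^ n * of_real (rGamma (b + 1 + a * real n))) * A"
      using bn[of n] by (simp add: abs_mult rGamma_inverse_Gamma add_ac mult_ac)
  qed
  have sF: "summable (\<lambda>n. norm (F n s))" for s
  proof (cases "0 < s \<and> s \<le> t")
    case True
    then show ?thesis using summable_rl_kernel_series[OF a b, of "t - s" z] t by (simp add: F_def summable_mult2)
  next
    case False
    then have "F n s = 0" for n using f0 by (auto simp: F_def)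
    then show ?thesis by simp
  qed
  have sint: "summable (\<lambda>n. LINT s|lborel. norm (F n s))"
    by (rule summable_comparison_test[OF _ summable_mult2[OF summable_power_rGamma[OF a, of z "b + 1"], of A]])
      (use int(3) in \<open>auto simp: integral_nonneg_AE\<close>)
  have "(\<Sum>n. of_real z ^ n * frac_int (b + a * real n) f t) = (LINT s|lborel. (\<Sum>n. F n s))"
    using integral_suminf[OF int(1) _ sint] sF int(2) by simp
  moreover have "norm (LINT s|lborel. (\<Sum>n. F n s))
      \<le> (LINT s|lborel. D * A * (rl_kernel d (t - s) * rl_kernel 1 (s - 0)))"
  proof (rule Bochner_Integration.integral_norm_bound_integral)
    show "integrable lborel (\<lambda>s. \<Sum>n. F n s)" using integrable_suminf[OF int(1) _ sint] sF by simp
    show "integrable lborel (\<lambda>s. D * A * (rl_kernel d (t - s) * rl_kernel 1 (s - 0)))"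
      using d by (intro integrable_mult_right integrable_rl_kernel_convolution) auto
    show "norm (\<Sum>n. F n s) \<le> D * A * (rl_kernel d (t - s) * rl_kernel 1 (s - 0))" for s
    proof (cases "0 < s \<and> s \<le> t")
      case True
      have "(\<Sum>n. F n s) = (\<Sum>n. z ^ n * rl_kernel (b + a * real n) (t - s)) *\<^sub>R f s"
        unfolding F_def using True t by (intro suminf_scaleR_left[symmetric] summable_norm_cancel[OF summable_rl_kernel_series[OF a b]]) auto
      then have "norm (\<Sum>n. F n s) = \<bar>\<Sum>n. z ^ n * rl_kernel (b + a * real n) (t - s)\<bar> * norm (f s)"
        by simp
      also have "\<dots> \<le> (D * rl_kernel d (t - s)) * (A * rl_kernel 1 s)"
        using True t order.trans[OF abs_ge_zero D[of "t - s"]] by (intro mult_mono A D) auto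
      finally show ?thesis by (simp add: mult_ac)
    next
      case False
      then have "F n s = 0" for n using f0 by (auto simp: F_def)
      moreover have "rl_kernel d (t - s) * rl_kernel 1 (s - 0) = 0" using False by auto
      ultimately show ?thesis by (simp only: suminf_zero norm_zero mult_zero_right order_refl)
    qed
  qed
  moreover have "(LINT s|lborel. D * A * (rl_kernel d (t - s) * rl_kernel 1 (s - 0))) = D * A * rl_kernel (d + 1) t"
    using integral_rl_kernel_convolution[OF d, of 1 t 0] by simp
  ultimately show ?thesis by (simp only:)
qed

section \<open>The characteristic function\<close>

text \<open>The potential is Borel and bounded at every point; the passage from an essentially
  bounded function to such a representative is made at the end, so no exceptional sets occur
  here.\<close>

locale fractional_problem =
  fixes \<alpha> C :: real and q :: "real \<Rightarrow> real"
  assumes alpha: "1 / 2 < \<alpha>" "\<alpha> < 1"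
    and q_measurable [measurable]: "q \<in> borel_measurable borel"
    and q_bound: "\<bar>q x\<bar> \<le> C"
begin

lemma C_nonneg: "C \<ge> 0"
  using q_bound[of 0] by linarith

lemma potential_bound: "norm (complex_of_real (q s) - \<mu>) \<le> C + norm \<mu>"
  using norm_triangle_ineq4[of "complex_of_real (q s)" \<mu>] q_bound[of s] by simp

lemma admissible_potential: "admissible f \<Longrightarrow> admissible (\<lambda>s. (of_real (q s) - \<mu>) * f s)"
  by (rule admissible_mult_bounded[OF _ potential_bound]) measurable

lemma admissible_q: "admissible f \<Longrightarrow> admissible (\<lambda>s. of_real (q s) * f s)"
  using admissible_potential[of f 0] by simp

section \<open>Neumann series and uniqueness for the integral equation\<close>

primrec iterate :: "complex \<Rightarrow> nat \<Rightarrow> real \<Rightarrow> complex" where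
  "iterate \<mu> 0 = (\<lambda>t. of_real (rl_kernel (\<alpha> + 1) t))"
| "iterate \<mu> (Suc n) = frac_int (2 * \<alpha>) (\<lambda>s. (of_real (q s) - \<mu>) * iterate \<mu> n s)"

definition solution :: "complex \<Rightarrow> real \<Rightarrow> complex" where
  "solution \<mu> t = (\<Sum>n. iterate \<mu> n t)"

definition charfun :: "complex \<Rightarrow> complex" where
  "charfun \<mu> = frac_int (1 - \<alpha>) (solution \<mu>) 1"

lemma admissible_iterate: "admissible (iterate \<mu> n)"
proof (induction n)
  case (Suc n)
  then show ?case using alpha by (auto intro!: admissible_frac_int admissible_potential)
qed (use alpha in \<open>auto intro: admissible_rl_kernel\<close>)

lemma norm_potential_mult_le:
  fixes f :: "real \<Rightarrow> complex"
  assumes "norm (f s) \<le> A * rl_kernel b s"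
  shows "norm ((of_real (q s) - \<mu>) * f s) \<le> (C + norm \<mu>) * A * rl_kernel b s"
  unfolding norm_mult mult.assoc
  by (rule mult_mono[OF potential_bound assms]) (use C_nonneg in auto)

text \<open>Each step raises the order of the kernel by 2 \<alpha> and contributes just the factor C
  + |\<mu>|. The Neumann series is thereby dominated by a Mittag-Leffler series.\<close>

lemma iterate_bound:
  "t \<le> 1 \<Longrightarrow> norm (iterate \<mu> n t) \<le> (C + norm \<mu>) ^ n * rl_kernel (\<alpha> + 1 + 2 * \<alpha> * real n) t"
proof (induction n arbitrary: t)
  case 0
  then show ?case using alpha by (simp add: rl_kernel_nonneg)
next
  case (Suc n)
  have "norm (frac_int (2 * \<alpha>) (\<lambda>s. (of_real (q s) - \<mu>) * iterate \<mu> n s) t)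
      \<le> (C + norm \<mu>) * (C + norm \<mu>) ^ n * rl_kernel (2 * \<alpha> + (\<alpha> + 1 + 2 * \<alpha> * real n)) t"
  proof (rule norm_frac_int_le)
    show "(\<lambda>s. (of_real (q s) - \<mu>) * iterate \<mu> n s) \<in> borel_measurable borel"
      by (intro admissible_measurable admissible_potential admissible_iterate)
    show "norm ((of_real (q s) - \<mu>) * iterate \<mu> n s) \<le> (C + norm \<mu>) * (C + norm \<mu>) ^ n * rl_kernel (\<alpha> + 1 + 2 * \<alpha> * real n) s"
      if "s \<le> t" for s
      using Suc.IH[of s] that Suc.prems by (intro norm_potential_mult_le) auto
  qed (use alpha in \<open>auto intro: add_pos_nonneg\<close>)
  then show ?case by (simp add: algebra_simps)
qed

definition iterate_majorant :: "complex \<Rightarrow> nat \<Rightarrow> real" where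
  "iterate_majorant \<mu> n = (C + norm \<mu>) ^ n * rGamma (\<alpha> + 1 + 2 * \<alpha> * real n)"

lemma iterate_bound': "t \<le> 1 \<Longrightarrow> norm (iterate \<mu> n t) \<le> iterate_majorant \<mu> n * rl_kernel 1 t"
proof -
  assume t: "t \<le> 1"
  have "rl_kernel (\<alpha> + 1 + 2 * \<alpha> * real n) t \<le> rGamma (\<alpha> + 1 + 2 * \<alpha> * real n) * rl_kernel 1 t"
    using alpha t by (intro rl_kernel_le) auto
  with iterate_bound[OF t, of \<mu> n] show ?thesis
    unfolding iterate_majorant_def mult.assoc
    using C_nonneg by (meson mult_left_mono order.trans zero_le_power add_nonneg_nonneg norm_ge_zero)
qed

lemma summable_power_rGamma_C: "summable (\<lambda>n. (C + norm \<mu>) ^ n * rGamma (b + 2 * \<alpha> * real n))"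
  using summable_norm_cancel[OF summable_power_rGamma[of "2 * \<alpha>" "C + norm \<mu>" b]] alpha by simp

lemma summable_iterate_majorant: "summable (iterate_majorant \<mu>)"
  unfolding iterate_majorant_def by (rule summable_power_rGamma_C)

lemma admissible_solution: "admissible (solution \<mu>)"
  unfolding solution_def[abs_def]
  by (rule admissible_suminf[OF admissible_measurable[OF admissible_iterate] zero_less_one iterate_bound' summable_iterate_majorant])

lemma summable_iterate: "t \<le> 1 \<Longrightarrow> summable (\<lambda>n. iterate \<mu> n t)"
  by (rule summable_norm_cancel, rule summable_comparison_test[OF _ summable_mult2[OF summable_iterate_majorant]])
    (use iterate_bound' in auto)

lemma solution_eq:
  assumes t: "t \<le> 1"
  shows "solution \<mu> t = of_real (rl_kernel (\<alpha> + 1) t) + frac_int (2 * \<alpha>) (\<lambda>s. (of_real (q s) - \<mu>) * solution \<mu> s) t"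
proof -
  have "(\<lambda>n. frac_int (2 * \<alpha>) (\<lambda>s. (of_real (q s) - \<mu>) * iterate \<mu> n s) t) sums
     frac_int (2 * \<alpha>) (\<lambda>s. \<Sum>n. (of_real (q s) - \<mu>) * iterate \<mu> n s) t"
  proof (rule frac_int_suminf[OF _ _ _ _ t])
    show "norm ((of_real (q s) - \<mu>) * iterate \<mu> n s) \<le> (C + norm \<mu>) * iterate_majorant \<mu> n * rl_kernel 1 s" if "s \<le> 1" for n s
      by (intro norm_potential_mult_le iterate_bound' that)
    show "summable (\<lambda>n. (C + norm \<mu>) * iterate_majorant \<mu> n)"
      by (intro summable_mult summable_iterate_majorant)
    show "(\<lambda>s. (of_real (q s) - \<mu>) * iterate \<mu> n s) \<in> borel_measurable borel" for n
      by (intro admissible_measurable admissible_potential admissible_iterate)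
  qed (use alpha in auto)
  also have "frac_int (2 * \<alpha>) (\<lambda>s. \<Sum>n. (of_real (q s) - \<mu>) * iterate \<mu> n s) t
      = frac_int (2 * \<alpha>) (\<lambda>s. (of_real (q s) - \<mu>) * solution \<mu> s) t"
    unfolding solution_def using t by (intro frac_int_cong suminf_mult summable_iterate) auto
  finally have "(\<lambda>n. iterate \<mu> (Suc n) t) sums frac_int (2 * \<alpha>) (\<lambda>s. (of_real (q s) - \<mu>) * solution \<mu> s) t"
    by simp
  then have "(\<lambda>n. iterate \<mu> n t) sums (frac_int (2 * \<alpha>) (\<lambda>s. (of_real (q s) - \<mu>) * solution \<mu> s) t + iterate \<mu> 0 t)"
    by (rule sums_Suc)
  then show ?thesis by (simp add: solution_def sums_iff)
qed

text \<open>Volterra uniqueness: putting the bound for f back into the equation n times leaves a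
  multiple of (C + |\<mu>|)^n / Gamma (1 + 2 \<alpha> n), which tends to 0.\<close>

lemma homogeneous_equation_trivial:
  assumes f: "admissible f" and eq: "\<And>t. t \<le> 1 \<Longrightarrow> f t = frac_int (2 * \<alpha>) (\<lambda>s. (of_real (q s) - \<mu>) * f s) t"
    and t: "t \<le> 1"
  shows "f t = 0"
  using f
proof (rule admissibleE)
  fix A assume A: "A \<ge> 0" "f \<in> borel_measurable borel" "\<And>s. s \<le> 1 \<Longrightarrow> norm (f s) \<le> A * rl_kernel 1 s"
  have bound: "norm (f t) \<le> (C + norm \<mu>) ^ n * A * rl_kernel (1 + 2 * \<alpha> * real n) t" if "t \<le> 1" for n t
    using that
  proof (induction n arbitrary: t)
    case 0
    then show ?case using A by simp
  next
    case (Suc n)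
    have "norm (frac_int (2 * \<alpha>) (\<lambda>s. (of_real (q s) - \<mu>) * f s) t)
        \<le> (C + norm \<mu>) * ((C + norm \<mu>) ^ n * A) * rl_kernel (2 * \<alpha> + (1 + 2 * \<alpha> * real n)) t"
    proof (rule norm_frac_int_le)
      show "(\<lambda>s. (of_real (q s) - \<mu>) * f s) \<in> borel_measurable borel"
        by (intro admissible_measurable admissible_potential f)
      show "norm ((of_real (q s) - \<mu>) * f s) \<le> (C + norm \<mu>) * ((C + norm \<mu>) ^ n * A) * rl_kernel (1 + 2 * \<alpha> * real n) s"
        if "s \<le> t" for s
        using Suc.IH[of s] that Suc.prems by (intro norm_potential_mult_le) auto
    qed (use alpha in \<open>auto intro: add_pos_nonneg\<close>)
    then show ?case using eq[OF Suc.prems] by (simp add: algebra_simps)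
  qed
  have "norm (f t) \<le> A * ((C + norm \<mu>) ^ n * rGamma (1 + 2 * \<alpha> * real n))" for n
  proof -
    have "norm (f t) \<le> (C + norm \<mu>) ^ n * A * rl_kernel (1 + 2 * \<alpha> * real n) t" by (rule bound[OF t])
    also have "\<dots> \<le> (C + norm \<mu>) ^ n * A * rGamma (1 + 2 * \<alpha> * real n)"
      using alpha t A C_nonneg by (intro mult_left_mono rl_kernel_le_rGamma) auto
    finally show ?thesis by (simp add: mult_ac)
  qed
  moreover have "(\<lambda>n. A * ((C + norm \<mu>) ^ n * rGamma (1 + 2 * \<alpha> * real n))) \<longlonglongrightarrow> A * 0"
    by (intro tendsto_intros summable_LIMSEQ_zero summable_power_rGamma_C)
  ultimately have "norm (f t) \<le> 0"
    by (intro LIMSEQ_le_const[where X = "\<lambda>n. A * ((C + norm \<mu>) ^ n * rGamma (1 + 2 * \<alpha> * real n))"]) auto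
  then show ?thesis by simp
qed

section \<open>Growth and holomorphy of the characteristic function\<close>

lemma charfun_sums: "(\<lambda>n. frac_int (1 - \<alpha>) (iterate \<mu> n) 1) sums charfun \<mu>"
  unfolding charfun_def solution_def[abs_def]
  using alpha
  by (intro frac_int_suminf[OF admissible_measurable[OF admissible_iterate] _ iterate_bound' summable_iterate_majorant]) auto

lemma charfun_term_bound: "norm (frac_int (1 - \<alpha>) (iterate \<mu> n) 1) \<le> (C + norm \<mu>) ^ n * rGamma (2 + 2 * \<alpha> * real n)"
proof -
  have "norm (frac_int (1 - \<alpha>) (iterate \<mu> n) 1)
      \<le> (C + norm \<mu>) ^ n * rl_kernel (1 - \<alpha> + (\<alpha> + 1 + 2 * \<alpha> * real n)) 1"
    using alpha by (intro norm_frac_int_le iterate_bound admissible_measurable admissible_iterate) (auto intro: add_pos_nonneg)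
  then show ?thesis by (simp add: rl_kernel_one_right)
qed

text \<open>The orders 1 - \<alpha> and \<alpha> + 1 add up to 2, so the majorant is the series in
  \<open>suminf_power_rGamma_le\<close>. The factor 1 stands for the constant \<open>A\<close> of
  \<open>entire_finite_zeros_bounded_below\<close>.\<close>

lemma charfun_growth: "norm (charfun \<mu>) \<le> 1 * exp (2 * \<alpha> * (C + norm \<mu>) powr (1 / (2 * \<alpha>)))"
proof -
  have "norm (charfun \<mu>) \<le> (\<Sum>n. (C + norm \<mu>) ^ n * rGamma (2 + 2 * \<alpha> * real n))"
    unfolding sums_unique[OF charfun_sums] by (rule norm_suminf_le[OF charfun_term_bound summable_power_rGamma_C])
  also have "\<dots> \<le> exp (2 * \<alpha> * (C + norm \<mu>) powr (1 / (2 * \<alpha>)))"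
    using alpha C_nonneg by (intro suminf_power_rGamma_le) auto
  finally show ?thesis by simp
qed

text \<open>Makes holomorphy in \<mu> purely algebraic, with no differentiation under the integral.
  The coefficients are admissible functions of t, so the boundary functional can be applied to each
  of them.\<close>

lemma iterate_polynomial:
  "\<exists>c. (\<forall>k. admissible (c k)) \<and> (\<forall>\<mu> t. t \<le> 1 \<longrightarrow> iterate \<mu> n t = (\<Sum>k\<le>n. \<mu> ^ k * c k t))"
proof (induction n)
  case 0
  show ?case
    using alpha by (intro exI[of _ "\<lambda>k t. of_real (rl_kernel (\<alpha> + 1) t)"]) (auto intro: admissible_rl_kernel)
next
  case (Suc n)
  then obtain c where c: "\<And>k. admissible (c k)" "\<And>\<mu> t. t \<le> 1 \<Longrightarrow> iterate \<mu> n t = (\<Sum>k\<le>n. \<mu> ^ k * c k t)"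
    by blast
  define d where "d k = frac_int (2 * \<alpha>) (\<lambda>s. of_real (q s) * c k s)" for k
  define e where "e k = frac_int (2 * \<alpha>) (c k)" for k
  \<comment> \<open>The coefficient k receives \<open>d k\<close> from multiplication by
    \<open>q\<close> and \<open>- e (k - 1)\<close> from multiplication by - \<mu>. The guards treat
    the end indices: \<open>d\<close> stops at n, and \<open>e\<close> does not reach k = 0.\<close>
  define c' where "c' k t = (if k \<le> n then d k t else 0) + (if k = 0 then 0 else - e (k - 1) t)" for k t
  have ad: "admissible (d k)" "admissible (e k)" for k
    using alpha c(1) by (auto simp: d_def e_def intro!: admissible_frac_int admissible_q)
  show ?case
  proof (intro exI[of _ c'] conjI allI impI)
    show "admissible (c' k)" for k
    proof -
      have "admissible (\<lambda>t. if k \<le> n then d k t else 0)"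
        by (cases "k \<le> n") (auto intro: ad admissible_zero)
      moreover have "admissible (\<lambda>t. if k = 0 then 0 else - e (k - 1) t)"
        by (cases "k = 0") (auto intro: ad admissible_zero admissible_uminus)
      ultimately show ?thesis unfolding c'_def by (rule admissible_add)
    qed
    fix \<mu> t assume t: "t \<le> (1::real)"
    define g where "g k s = of_real (q s) * c k s + - (\<mu> * c k s)" for k s
    have g: "admissible (g k)" "frac_int (2 * \<alpha>) (g k) t = d k t - \<mu> * e k t" for k
      unfolding g_def[abs_def] using t alpha c(1)
      by (simp_all add: admissible_add admissible_q admissible_cmult admissible_uminus
          frac_int_add frac_int_uminus frac_int_cmult d_def e_def del: add_uminus_conv_diff)
    have 1: "iterate \<mu> (Suc n) t = frac_int (2 * \<alpha>) (\<lambda>s. \<Sum>k\<le>n. \<mu> ^ k * g k s) t"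
      unfolding iterate.simps
      by (intro frac_int_cong) (use t in \<open>auto simp: c(2) g_def sum_distrib_left algebra_simps\<close>)
    also have "\<dots> = (\<Sum>k\<le>n. \<mu> ^ k * (d k t - \<mu> * e k t))"
      using t alpha by (subst frac_int_sum) (auto simp: frac_int_cmult g intro!: admissible_cmult)
    also have "\<dots> = (\<Sum>k\<le>n. \<mu> ^ k * d k t) + (\<Sum>k\<le>n. \<mu> ^ Suc k * (- e k t))"
      by (simp add: algebra_simps sum.distrib sum_subtractf sum_negf)
    also have "(\<Sum>k\<le>n. \<mu> ^ k * d k t) = (\<Sum>k\<le>Suc n. \<mu> ^ k * (if k \<le> n then d k t else 0))"
      by (simp add: sum.atMost_Suc)
    also have "(\<Sum>k\<le>n. \<mu> ^ Suc k * (- e k t)) = (\<Sum>k\<le>Suc n. \<mu> ^ k * (if k = 0 then 0 else - e (k - 1) t))"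
      by (subst sum.atMost_Suc_shift) simp
    finally show "iterate \<mu> (Suc n) t = (\<Sum>k\<le>Suc n. \<mu> ^ k * c' k t)"
      by (simp add: c'_def sum.distrib distrib_left del: sum.atMost_Suc)
  qed
qed

lemma holomorphic_charfun_term: "(\<lambda>\<mu>. frac_int (1 - \<alpha>) (iterate \<mu> n) 1) holomorphic_on S"
proof -
  obtain c where c: "\<And>k. admissible (c k)" "\<And>\<mu> t. t \<le> 1 \<Longrightarrow> iterate \<mu> n t = (\<Sum>k\<le>n. \<mu> ^ k * c k t)"
    using iterate_polynomial[of n] by blast
  have "frac_int (1 - \<alpha>) (iterate \<mu> n) 1 = (\<Sum>k\<le>n. \<mu> ^ k * frac_int (1 - \<alpha>) (c k) 1)" for \<mu>
  proof -
    have "frac_int (1 - \<alpha>) (iterate \<mu> n) 1 = frac_int (1 - \<alpha>) (\<lambda>t. \<Sum>k\<le>n. \<mu> ^ k * c k t) 1"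
      by (intro frac_int_cong c(2)) auto
    also have "\<dots> = (\<Sum>k\<le>n. \<mu> ^ k * frac_int (1 - \<alpha>) (c k) 1)"
      using alpha c(1) by (subst frac_int_sum) (auto simp: frac_int_cmult intro!: admissible_cmult)
    finally show ?thesis .
  qed
  then show ?thesis by (simp only:) (intro holomorphic_intros)
qed

lemma holomorphic_charfun: "charfun holomorphic_on UNIV"
proof (rule holomorphic_uniform_sequence[of _ "\<lambda>N \<mu>. \<Sum>n<N. frac_int (1 - \<alpha>) (iterate \<mu> n) 1"])
  show "(\<lambda>\<mu>. \<Sum>n<N. frac_int (1 - \<alpha>) (iterate \<mu> n) 1) holomorphic_on UNIV" for N
    by (intro holomorphic_intros holomorphic_charfun_term)
  show "\<exists>d>0. cball \<mu>0 d \<subseteq> UNIV \<and>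
      uniform_limit (cball \<mu>0 d) (\<lambda>N \<mu>. \<Sum>n<N. frac_int (1 - \<alpha>) (iterate \<mu> n) 1) charfun sequentially" for \<mu>0
  proof (intro exI[of _ 1] conjI)
    have eq: "charfun \<mu> = (\<Sum>n. frac_int (1 - \<alpha>) (iterate \<mu> n) 1)" for \<mu>
      using charfun_sums by (rule sums_unique)
    show "uniform_limit (cball \<mu>0 1) (\<lambda>N \<mu>. \<Sum>n<N. frac_int (1 - \<alpha>) (iterate \<mu> n) 1) charfun sequentially"
      unfolding eq[abs_def]
    proof (rule Weierstrass_m_test)
      fix n \<mu> assume "\<mu> \<in> cball \<mu>0 1"
      then have "norm \<mu> \<le> norm \<mu>0 + 1"
        using norm_triangle_ineq2[of \<mu> \<mu>0] by (simp add: dist_norm norm_minus_commute)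
      \<comment> \<open>The radius is written as the norm of a complex number so that
        \<open>summable_power_rGamma_C\<close> gives the summability of the majorant.\<close>
      then have "(C + norm \<mu>) ^ n \<le> (C + norm (complex_of_real (norm \<mu>0 + 1))) ^ n"
        using C_nonneg unfolding norm_of_real by (intro power_mono) auto
      moreover have "rGamma (2 + 2 * \<alpha> * real n) \<ge> 0"
        using alpha by (simp add: rGamma_inverse_Gamma add_pos_nonneg)
      ultimately show "norm (frac_int (1 - \<alpha>) (iterate \<mu> n) 1)
          \<le> (C + norm (complex_of_real (norm \<mu>0 + 1))) ^ n * rGamma (2 + 2 * \<alpha> * real n)"
        using charfun_term_bound[of \<mu> n] by (meson mult_right_mono order.trans)
    qed (rule summable_power_rGamma_C)
  qed auto
qed auto

end

section \<open>Real spectral parameters\<close>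

lemma frac_int_nonneg_Reals:
  assumes "\<And>s. f s \<in> \<real>\<^sub>\<ge>\<^sub>0" "\<beta> > 0"
  shows "frac_int \<beta> f t \<in> \<real>\<^sub>\<ge>\<^sub>0"
proof -
  have e: "rl_kernel \<beta> (t - s) *\<^sub>R f s = of_real (rl_kernel \<beta> (t - s) * Re (f s))" for s
    using assms(1)[of s] by (auto elim: nonneg_Reals_cases simp: scaleR_conv_of_real)
  have "frac_int \<beta> f t = of_real (LINT s|lborel. rl_kernel \<beta> (t - s) * Re (f s))"
    unfolding frac_int_def e by (rule integral_complex_of_real)
  moreover have "(LINT s|lborel. rl_kernel \<beta> (t - s) * Re (f s)) \<ge> 0"
    using assms by (intro integral_nonneg_AE AE_I2 mult_nonneg_nonneg rl_kernel_nonneg)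
      (simp_all add: complex_nonneg_Reals_iff)
  ultimately show ?thesis by simp
qed

context fractional_problem
begin

section \<open>Negative spectral parameters\<close>

lemma iterate_nonneg:
  assumes "m \<le> - C"
  shows "iterate (of_real m) n t \<in> \<real>\<^sub>\<ge>\<^sub>0"
proof (induction n arbitrary: t)
  case 0
  then show ?case using alpha by (simp add: rl_kernel_nonneg)
next
  case (Suc n)
  have "complex_of_real (q s) - of_real m \<in> \<real>\<^sub>\<ge>\<^sub>0" for s
    using q_bound[of s] assms by (simp add: complex_nonneg_Reals_iff)
  with Suc alpha show ?case
    by (auto intro!: frac_int_nonneg_Reals nonneg_Reals_mult_I)
qed

lemma Re_charfun_ge_1:
  assumes "m \<le> - C"
  shows "Re (charfun (of_real m)) \<ge> 1"
proof -
  let ?f = "\<lambda>n. frac_int (1 - \<alpha>) (iterate (of_real m) n) 1"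
  have "?f n \<in> \<real>\<^sub>\<ge>\<^sub>0" for n
    using alpha by (intro frac_int_nonneg_Reals iterate_nonneg assms) auto
  then have nn: "Re (?f n) \<ge> 0" for n by (simp add: complex_nonneg_Reals_iff)
  \<comment> \<open>The orders 1 - \<alpha> and \<alpha> + 1 add up to 2, and Gamma 2 = 1.\<close>
  have "?f 0 = 1"
    using alpha Gamma_fact[of 1, where 'a = real] by (simp add: frac_int_rl_kernel rl_kernel_one_right rGamma_inverse_Gamma)
  then have "1 = (\<Sum>n\<in>{0}. Re (?f n))" by simp
  also have "\<dots> \<le> (\<Sum>n. Re (?f n))"
    using charfun_sums[of "of_real m"] nn by (intro sum_le_suminf sums_summable[OF sums_Re]) auto
  also have "\<dots> = Re (charfun (of_real m))"
    using sums_Re[OF charfun_sums[of "of_real m"]] by (simp add: sums_iff)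
  finally show ?thesis .
qed

section \<open>Large positive spectral parameters\<close>

lemma solution_eq_split:
  assumes t: "t \<le> 1"
  shows "solution \<mu> t = of_real (rl_kernel (\<alpha> + 1) t)
    + frac_int (2 * \<alpha>) (\<lambda>s. of_real (q s) * solution \<mu> s) t - \<mu> * frac_int (2 * \<alpha>) (solution \<mu>) t"
proof -
  let ?f = "\<lambda>s. of_real (q s) * solution \<mu> s" and ?y = "solution \<mu>"
  have "(\<lambda>s. (of_real (q s) - \<mu>) * ?y s) = (\<lambda>s. ?f s + - (\<mu> * ?y s))" by (simp add: fun_eq_iff algebra_simps)
  then have "frac_int (2 * \<alpha>) (\<lambda>s. (of_real (q s) - \<mu>) * ?y s) t = frac_int (2 * \<alpha>) ?f t + - (\<mu> * frac_int (2 * \<alpha>) ?y t)"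
    using t alpha by (simp only:) (subst frac_int_add; auto simp: frac_int_uminus frac_int_cmult
        intro!: admissible_uminus admissible_cmult admissible_q admissible_solution)
  with solution_eq[OF t, of \<mu>] show ?thesis by (simp add: algebra_simps)
qed

text \<open>The recursion behind \<open>resolvent_expansion\<close>: the last term is of the same
  kind as the left side, with the order raised by 2 \<alpha> and a factor - \<mu>.\<close>

lemma frac_int_solution_step:
  assumes b: "b > 0" and t: "t \<le> 1"
  shows "frac_int b (solution \<mu>) t = of_real (rl_kernel (b + (\<alpha> + 1)) t)
    + frac_int (b + 2 * \<alpha>) (\<lambda>s. of_real (q s) * solution \<mu> s) t - \<mu> * frac_int (b + 2 * \<alpha>) (solution \<mu>) t"
proof -
  let ?f = "\<lambda>s. of_real (q s) * solution \<mu> s" and ?y = "solution \<mu>"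
  have a: "2 * \<alpha> > 0" using alpha by simp
  note ad = admissible_solution[of \<mu>] admissible_q[OF admissible_solution[of \<mu>]]
  have ad': "admissible (\<lambda>t. of_real (rl_kernel (\<alpha> + 1) t))" "admissible (frac_int (2 * \<alpha>) ?f)" "admissible (frac_int (2 * \<alpha>) ?y)"
    using alpha a ad by (auto intro!: admissible_rl_kernel admissible_frac_int)
  have "frac_int b ?y t = frac_int b (\<lambda>t. of_real (rl_kernel (\<alpha> + 1) t) + frac_int (2 * \<alpha>) ?f t + - (\<mu> * frac_int (2 * \<alpha>) ?y t)) t"
    by (rule frac_int_cong) (use t in \<open>simp add: solution_eq_split\<close>)
  also have "\<dots> = frac_int b (\<lambda>t. of_real (rl_kernel (\<alpha> + 1) t)) t + frac_int b (frac_int (2 * \<alpha>) ?f) t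
      + - (\<mu> * frac_int b (frac_int (2 * \<alpha>) ?y) t)"
    using ad' b t by (simp add: frac_int_add admissible_add admissible_uminus admissible_cmult frac_int_uminus frac_int_cmult del: add_uminus_conv_diff)
  also have "\<dots> = of_real (rl_kernel (b + (\<alpha> + 1)) t) + frac_int (b + 2 * \<alpha>) ?f t - \<mu> * frac_int (b + 2 * \<alpha>) ?y t"
    using alpha a ad b t by (simp add: frac_int_rl_kernel frac_int_semigroup)
  finally show "frac_int b ?y t = of_real (rl_kernel (b + (\<alpha> + 1)) t) + frac_int (b + 2 * \<alpha>) ?f t - \<mu> * frac_int (b + 2 * \<alpha>) ?y t" .
qed

text \<open>Variation of constants, with the potential \<open>q\<close> as the perturbation. The case \<open>b = 0\<close> cannot be stated
  with \<open>X = frac_int 0 (solution l) t\<close>, since \<open>Gamma 0 = 0\<close> makes \<open>rl_kernel 0\<close> vanish; hence the variable \<open>X\<close>.\<close>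

lemma resolvent_expansion:
  fixes l :: real
  defines "f \<equiv> (\<lambda>s. of_real (q s) * solution (of_real l) s)"
  assumes b: "b \<ge> 0" and t: "t \<le> 1"
    and X: "X = of_real (rl_kernel (b + (\<alpha> + 1)) t) + frac_int (b + 2 * \<alpha>) f t - of_real l * frac_int (b + 2 * \<alpha>) (solution (of_real l)) t"
  shows "X = of_real (\<Sum>n. (- l) ^ n * rl_kernel ((b + (\<alpha> + 1)) + 2 * \<alpha> * real n) t)
             + (\<Sum>n. of_real (- l) ^ n * frac_int ((b + 2 * \<alpha>) + 2 * \<alpha> * real n) f t)"
proof -
  let ?y = "solution (of_real l)"
  let ?u = "\<lambda>n. complex_of_real ((- l) ^ n * rl_kernel ((b + (\<alpha> + 1)) + 2 * \<alpha> * real n) t)"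
  let ?v = "\<lambda>n. of_real (- l) ^ n * frac_int ((b + 2 * \<alpha>) + 2 * \<alpha> * real n) f t"
  let ?r = "\<lambda>n. of_real (- l) ^ n * frac_int ((b + 2 * \<alpha>) + 2 * \<alpha> * real n) ?y t"
  have a: "2 * \<alpha> > 1" using alpha by simp
  \<comment> \<open>The recursion substituted N times into the remainder.\<close>
  have part: "X = (\<Sum>n\<le>N. ?u n + ?v n) - of_real l * ?r N" for N
  proof (induction N)
    case 0
    then show ?case by (simp add: X)
  next
    case (Suc N)
    have "b + 2 * \<alpha> + 2 * \<alpha> * real N > 0" using a b by (simp add: add_nonneg_pos add_pos_nonneg)
    from frac_int_solution_step[OF this t, of "of_real l"] 
    have "frac_int ((b + 2 * \<alpha>) + 2 * \<alpha> * real N) ?y t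
       = of_real (rl_kernel ((b + (\<alpha> + 1)) + 2 * \<alpha> * real (Suc N)) t)
        + frac_int ((b + 2 * \<alpha>) + 2 * \<alpha> * real (Suc N)) f t - of_real l * frac_int ((b + 2 * \<alpha>) + 2 * \<alpha> * real (Suc N)) ?y t"
      by (simp add: f_def algebra_simps)
    note e = this
    have "- (of_real l * ?r N) = of_real (- l) ^ Suc N * frac_int ((b + 2 * \<alpha>) + 2 * \<alpha> * real N) ?y t"
      by simp
    also have "\<dots> = ?u (Suc N) + ?v (Suc N) - of_real l * ?r (Suc N)"
      unfolding e of_real_mult of_real_power by (simp only: distrib_left right_diff_distrib mult_ac)
    finally have "- (of_real l * ?r N) = ?u (Suc N) + ?v (Suc N) - of_real l * ?r (Suc N)" .
    with Suc show ?case by simp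
  qed
  have shift: "b + 2 * \<alpha> + 2 * \<alpha> * real n = b + 2 * \<alpha> * real (Suc n)" for n by (simp add: algebra_simps)
  have u: "summable ?u"
    using a alpha b by (intro summable_of_real summable_norm_cancel[OF summable_rl_kernel_series] t) auto
  have v: "summable ?v"
    unfolding shift f_def
    by (intro summable_norm_cancel[OF abs_summable_frac_int_series[OF a b _ t]] admissible_q admissible_solution)
  have "summable ?r"
    unfolding shift
    by (intro summable_norm_cancel[OF abs_summable_frac_int_series[OF a b _ t]] admissible_solution)
  \<comment> \<open>Here l is fixed: the powers of l lose against the Gamma denominators hidden in
    the fractional integrals of growing order.\<close>
  then have r: "?r \<longlonglongrightarrow> 0" by (rule summable_LIMSEQ_zero)
  have "(\<lambda>N. (\<Sum>n\<le>N. ?u n + ?v n) - of_real l * ?r N) \<longlonglongrightarrow> (\<Sum>n. ?u n + ?v n) - of_real l * 0"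
    by (intro tendsto_intros r summable_LIMSEQ' summable_add u v)
  then have "(\<lambda>N. X) \<longlonglongrightarrow> (\<Sum>n. ?u n + ?v n)"
    unfolding part[symmetric] by simp
  then have "X = (\<Sum>n. ?u n + ?v n)" by (simp add: LIMSEQ_const_iff)
  also have "\<dots> = suminf ?u + suminf ?v" by (rule suminf_add[OF u v, symmetric])
  also have "suminf ?u = of_real (\<Sum>n. (- l) ^ n * rl_kernel ((b + (\<alpha> + 1)) + 2 * \<alpha> * real n) t)"
    using a alpha b by (intro suminf_of_real[symmetric] summable_norm_cancel[OF summable_rl_kernel_series] t) auto
  finally show ?thesis .
qed

text \<open>Absorption: by the expansion around q = 0 the supremum Y of the solution satisfies Y <=
  M1 l powr (-1/2) + (M2 l powr (- c) C) Y, and for large l the factor of Y on the right is below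
  1/2.\<close>

lemma solution_decay:
  "\<exists>M\<ge>0. \<exists>L>0. \<forall>l\<ge>L. \<forall>t\<le>1. norm (solution (of_real l) t) \<le> M * l powr (- (1 / 2)) * rl_kernel 1 t"
proof -
  define a where "a = 2 * \<alpha>"
  \<comment> \<open>Solves a - a c = 1, just as the exponent 1/2 solves \<alpha> + 1 - a / 2 = 1.
    Both kernel bounds then come out as multiples of \<open>rl_kernel 1\<close>.\<close>
  define c where "c = (a - 1) / a"
  have a: "1 < a" "a < 2" using alpha by (auto simp: a_def)
  have c: "0 < c" "c < 1" "a - a * c = 1" using a by (auto simp: c_def field_simps)
  have half: "\<alpha> + 1 - a * (1 / 2) = 1" by (simp add: a_def)
  obtain M1 where M1: "M1 \<ge> 0" "\<And>l x. l > 0 \<Longrightarrow>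
      \<bar>\<Sum>n. (- l) ^ n * rl_kernel ((\<alpha> + 1) + a * real n) x\<bar> \<le> M1 * l powr (- (1 / 2)) * rl_kernel 1 x"
    using Mittag_Leffler_kernel_bound[OF a, of "1 / 2" "\<alpha> + 1"] unfolding half by auto
  obtain M2 where M2: "M2 \<ge> 0" "\<And>l x. l > 0 \<Longrightarrow>
      \<bar>\<Sum>n. (- l) ^ n * rl_kernel (a + a * real n) x\<bar> \<le> M2 * l powr (- c) * rl_kernel 1 x"
    using Mittag_Leffler_kernel_bound[OF a c(1,2), of a] unfolding c(3) by auto
  have "((\<lambda>l. M2 * l powr (- c) * C) \<longlongrightarrow> M2 * 0 * C) at_top"
    using c by (intro tendsto_intros tendsto_neg_powr filterlim_ident) auto
  then have "\<forall>\<^sub>F l in at_top. M2 * l powr (- c) * C < 1 / 2"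
    by (rule order_tendstoD) simp
  then obtain L0 where L0: "\<And>l. l \<ge> L0 \<Longrightarrow> M2 * l powr (- c) * C < 1 / 2"
    by (auto simp: eventually_at_top_linorder)
  show ?thesis
  proof (rule exI[of _ "2 * M1"], intro conjI exI[of _ "max L0 1"] allI impI)
    fix l t :: real assume l: "l \<ge> max L0 1" and t: "t \<le> 1"
    let ?y = "solution (of_real l)"
    obtain A where A: "A \<ge> 0" "?y \<in> borel_measurable borel" "\<And>s. s \<le> 1 \<Longrightarrow> norm (?y s) \<le> A * rl_kernel 1 s"
      using admissible_solution[of "of_real l"] by (rule admissibleE) (rule that)
    have A': "norm (?y s) \<le> A" if "s \<le> 1" for s
      using A(3)[OF that] A(1) by (auto simp: rl_kernel_one split: if_splits)
    define Y where "Y = (SUP s\<in>{..1}. norm (?y s))"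
    \<comment> \<open>Finiteness of Y is known beforehand, from admissibility with a constant that
      may depend on l; this is what allows Y / 2 to be subtracted.\<close>
    have bdd: "bdd_above ((\<lambda>s. norm (?y s)) ` {..1})" using A' by (intro bdd_aboveI2[of _ _ A]) auto
    have Y: "norm (?y s) \<le> Y" if "s \<le> 1" for s unfolding Y_def by (rule cSUP_upper[OF _ bdd]) (use that in auto)
    have Y0: "Y \<ge> 0" using order.trans[OF norm_ge_zero Y[of 0]] by simp
    have Yk: "norm (?y s) \<le> Y * rl_kernel 1 s" if "s \<le> 1" for s
      using Y[OF that] admissible_eq_0[OF admissible_solution, of s] by (auto simp: rl_kernel_one)
    have le: "norm (?y s) \<le> (M1 * l powr (- (1 / 2)) + Y / 2) * rl_kernel 1 s" if s: "s \<le> 1" for s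
    proof -
      have e: "?y s = of_real (\<Sum>n. (- l) ^ n * rl_kernel ((\<alpha> + 1) + a * real n) s)
             + (\<Sum>n. of_real (- l) ^ n * frac_int (a + a * real n) (\<lambda>s. of_real (q s) * ?y s) s)"
        using resolvent_expansion[of 0 s, OF _ s] solution_eq_split[OF s, of "of_real l"] by (simp add: a_def)
      have "norm (\<Sum>n. of_real (- l) ^ n * frac_int (a + a * real n) (\<lambda>s. of_real (q s) * ?y s) s)
          \<le> (M2 * l powr (- c)) * (C * Y) * rl_kernel (1 + 1) s"
      proof (rule frac_int_series_bound[OF a(1)])
        show "norm (of_real (q s) * ?y s) \<le> C * Y * rl_kernel 1 s" if "s \<le> 1" for s
          using norm_potential_mult_le[where f = ?y and b = 1 and \<mu> = 0, OF Yk[OF that]] by simp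
        show "\<bar>\<Sum>n. (- l) ^ n * rl_kernel (a + a * real n) x\<bar> \<le> M2 * l powr - c * rl_kernel 1 x" for x
          using l by (intro M2) auto
      qed (use a s in \<open>auto intro!: admissible_measurable admissible_q admissible_solution\<close>)
      also have "\<dots> \<le> Y / 2 * rl_kernel 1 s"
      proof -
        have f1: "(M2 * l powr (- c)) * (C * Y) \<le> 1 / 2 * Y"
          using L0[of l] l Y0 mult_right_mono[of "M2 * l powr (- c) * C" "1 / 2" Y] by (simp add: mult_ac)
        have f2: "rl_kernel (1 + 1) s \<le> rl_kernel 1 s"
          using rl_kernel_le[of 2 s] s Gamma_fact[of 1, where 'a = real] by (simp add: rGamma_inverse_Gamma)
        have "(M2 * l powr (- c)) * (C * Y) * rl_kernel (1 + 1) s \<le> (1 / 2 * Y) * rl_kernel 1 s"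
          using Y0 by (intro mult_mono[OF f1 f2]) (auto simp: rl_kernel_nonneg)
        then show ?thesis by simp
      qed
      finally have V: "norm (\<Sum>n. of_real (- l) ^ n * frac_int (a + a * real n) (\<lambda>s. of_real (q s) * ?y s) s) \<le> Y / 2 * rl_kernel 1 s" .
      have U: "norm (complex_of_real (\<Sum>n. (- l) ^ n * rl_kernel ((\<alpha> + 1) + a * real n) s)) \<le> M1 * l powr (- (1 / 2)) * rl_kernel 1 s"
        using M1(2)[of l s] l by simp
      show ?thesis
        unfolding distrib_right by (subst e) (rule norm_triangle_mono[OF U V])
    qed
    have "Y \<le> M1 * l powr (- (1 / 2)) + Y / 2"
      unfolding Y_def
    proof (rule cSUP_least)
      fix s :: real assume "s \<in> {..1}"
      then show "norm (?y s) \<le> M1 * l powr (- (1 / 2)) + (SUP s\<in>{..1}. norm (?y s)) / 2"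
        using le[of s] M1(1) Y0 unfolding Y_def[symmetric] by (auto simp: rl_kernel_one split: if_splits)
    qed auto
    then have "Y \<le> 2 * M1 * l powr (- (1 / 2))" by simp
    then have "Y * rl_kernel 1 t \<le> 2 * M1 * l powr (- (1 / 2)) * rl_kernel 1 t"
      by (rule mult_right_mono) (simp add: rl_kernel_nonneg)
    with Yk[OF t] show "norm (?y t) \<le> 2 * M1 * l powr (- (1 / 2)) * rl_kernel 1 t" by linarith
  qed (use M1 in auto)
qed

text \<open>The unperturbed part gives the limit exactly up to a Mittag-Leffler remainder. The part
  with \<open>q\<close> decays like l powr (-5/4), the product of the decay of the kernel and that
  of the solution, and so survives multiplication by l.\<close>

lemma charfun_asymptotics:
  "((\<lambda>l::real. of_real l * charfun (of_real l)) \<longlongrightarrow> of_real (rGamma (2 - 2 * \<alpha>))) at_top"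
proof -
  define a where "a = 2 * \<alpha>"
  have a: "1 < a" "a < 2" using alpha by (auto simp: a_def)
  \<comment> \<open>The exponent 3/4 exceeds 1/2, so that together with
    \<open>solution_decay\<close> the total exceeds 1, and it still leaves d = 1 - \<alpha> / 2
    positive.\<close>
  define d where "d = \<alpha> + 1 - a * (3 / 4)"
  have d: "d > 0" using alpha by (simp add: d_def a_def)
  obtain M1 L where L: "M1 \<ge> 0" "L > 0" "\<And>l t. l \<ge> L \<Longrightarrow> t \<le> 1 \<Longrightarrow>
      norm (solution (of_real l) t) \<le> M1 * l powr (- (1 / 2)) * rl_kernel 1 t"
    using solution_decay by blast
  obtain M3 where M3: "M3 \<ge> 0" "\<And>l x. l > 0 \<Longrightarrow>
      \<bar>\<Sum>n. (- l) ^ n * rl_kernel ((\<alpha> + 1) + a * real n) x\<bar> \<le> M3 * l powr (- (3 / 4)) * rl_kernel d x"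
    using Mittag_Leffler_kernel_bound[OF a, of "3 / 4" "\<alpha> + 1"] d unfolding d_def by auto
  obtain M4 where M4: "M4 \<ge> 0" "\<And>z. z > 0 \<Longrightarrow> \<bar>\<Sum>n. (- z) ^ n * rGamma ((2 - a) + a * real n)\<bar> \<le> M4 * z powr (- (1 / 2))"
    using Mittag_Leffler_bound[OF a, of "1 / 2" "2 - a"] by auto
  define K where "K = M3 * (C * M1) * rGamma (d + 1)"
  have bound: "norm (of_real l * charfun (of_real l) - of_real (rGamma (2 - a))) \<le> M4 * l powr (- (1 / 2)) + K * l powr (- (1 / 4))"
    if l: "l \<ge> L" for l
  proof -
    have l0: "l > 0" using l L(2) by simp
    let ?f = "\<lambda>s. of_real (q s) * solution (of_real l) s"
    define E where "E = (\<Sum>n. (- l) ^ n * rGamma (2 + a * real n))"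
    define P where "P = (\<Sum>n. of_real (- l) ^ n * frac_int ((\<alpha> + 1) + a * real n) ?f 1)"
    \<comment> \<open>The expansion with b = 1 - \<alpha>: its two orders become b + \<alpha> + 1 =
      2 and b + 2 \<alpha> = \<alpha> + 1.\<close>
    have "charfun (of_real l) = of_real E + P"
      using resolvent_expansion[of "1 - \<alpha>" 1 "charfun (of_real l)" l]
        frac_int_solution_step[of "1 - \<alpha>" 1 "of_real l"] alpha
      unfolding E_def P_def a_def charfun_def by (simp add: rl_kernel_one_right algebra_simps)
    \<comment> \<open>Splitting off the term n = 0 of the series with parameter 2 - a and shifting
      the index leaves - l times the series with parameter 2.\<close>
    moreover have "l * E = rGamma (2 - a) - (\<Sum>n. (- l) ^ n * rGamma ((2 - a) + a * real n))"
    proof -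
      have s: "summable (\<lambda>n. (- l) ^ n * rGamma (b + a * real n))" for b
        using summable_norm_cancel[OF summable_power_rGamma[OF a(1), of "- l" b]] by simp
      have "(\<Sum>n. (- l) ^ n * rGamma ((2 - a) + a * real n))
          = (\<Sum>n. (- l) ^ Suc n * rGamma ((2 - a) + a * real (Suc n))) + rGamma (2 - a)"
        using suminf_split_head[OF s[of "2 - a"]] by simp
      also have "(\<lambda>n. (- l) ^ Suc n * rGamma ((2 - a) + a * real (Suc n))) = (\<lambda>n. - l * ((- l) ^ n * rGamma (2 + a * real n)))"
        by (simp add: fun_eq_iff algebra_simps)
      also have "(\<Sum>n. - l * ((- l) ^ n * rGamma (2 + a * real n))) = - l * E"
        unfolding E_def by (rule suminf_mult[OF s])
      finally show ?thesis by simp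
    qed
    ultimately have eq: "of_real l * charfun (of_real l) - of_real (rGamma (2 - a))
        = of_real (- (\<Sum>n. (- l) ^ n * rGamma ((2 - a) + a * real n))) + of_real l * P"
      by (simp add: distrib_left flip: of_real_mult)
    have "norm P \<le> (M3 * l powr (- (3 / 4))) * (C * (M1 * l powr (- (1 / 2)))) * rl_kernel (d + 1) 1"
      unfolding P_def
    proof (rule frac_int_series_bound[OF a(1) _ d])
      show "norm (?f s) \<le> C * (M1 * l powr (- (1 / 2))) * rl_kernel 1 s" if "s \<le> 1" for s
        using norm_potential_mult_le[where f = "solution (of_real l)" and b = 1 and \<mu> = 0, OF L(3)[OF l that]] by simp
      show "\<bar>\<Sum>n. (- l) ^ n * rl_kernel ((\<alpha> + 1) + a * real n) x\<bar> \<le> M3 * l powr (- (3 / 4)) * rl_kernel d x" for x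
        by (rule M3(2)[OF l0])
    qed (use alpha in \<open>auto intro!: admissible_measurable admissible_q admissible_solution\<close>)
    then have "l * norm P \<le> l * ((M3 * l powr (- (3 / 4))) * (C * (M1 * l powr (- (1 / 2)))) * rl_kernel (d + 1) 1)"
      using l0 by (intro mult_left_mono) auto
    also have "\<dots> = K * (l powr 1 * l powr (- (3 / 4)) * l powr (- (1 / 2)))"
      using l0 by (simp add: K_def rl_kernel_one_right mult_ac)
    also have "l powr 1 * l powr (- (3 / 4)) * l powr (- (1 / 2)) = l powr (- (1 / 4))"
      unfolding powr_add[symmetric] by simp
    finally have "norm (of_real l * P) \<le> K * l powr (- (1 / 4))" using l0 by (simp add: norm_mult)
    moreover have "norm (complex_of_real (- (\<Sum>n. (- l) ^ n * rGamma ((2 - a) + a * real n)))) \<le> M4 * l powr (- (1 / 2))"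
      using M4(2)[OF l0] unfolding norm_of_real abs_minus_cancel .
    ultimately show ?thesis unfolding eq by (intro norm_triangle_mono)
  qed
  have "((\<lambda>l. M4 * l powr (- (1 / 2)) + K * l powr (- (1 / 4))) \<longlongrightarrow> M4 * 0 + K * 0) at_top"
    by (intro tendsto_intros tendsto_neg_powr filterlim_ident) auto
  then have "((\<lambda>l::real. of_real l * charfun (of_real l) - of_real (rGamma (2 - a))) \<longlongrightarrow> 0) at_top"
    by (intro Lim_null_comparison[OF eventually_mono[OF eventually_ge_at_top[of L] bound]]) simp_all
  then show ?thesis unfolding a_def by (simp add: LIM_zero_iff)
qed

lemma charfun_tendsto_0: "((\<lambda>l::real. charfun (of_real l)) \<longlongrightarrow> 0) at_top"
proof -
  have "((\<lambda>l::real. complex_of_real (inverse l)) \<longlongrightarrow> of_real 0) at_top"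
    by (intro tendsto_of_real tendsto_inverse_0_at_top filterlim_ident)
  from tendsto_mult[OF this charfun_asymptotics]
  have "((\<lambda>l::real. of_real (inverse l) * (of_real l * charfun (of_real l))) \<longlongrightarrow> 0) at_top" by simp
  then show ?thesis
    by (rule Lim_transform_eventually) (rule eventually_mono[OF eventually_gt_at_top[of 0]], simp)
qed

section \<open>Real and non-real zeros\<close>

lemma finite_real_zeros: "finite {\<mu>. charfun \<mu> = 0 \<and> \<mu> \<in> \<real>}"
proof -
  have "rGamma (2 - 2 * \<alpha>) > 0" using alpha by (simp add: rGamma_inverse_Gamma)
  then have "\<forall>\<^sub>F l::real in at_top. of_real l * charfun (of_real l) \<noteq> 0"
    by (intro tendsto_imp_eventually_ne[OF charfun_asymptotics]) auto
  then obtain L where L: "\<And>l. l \<ge> L \<Longrightarrow> charfun (of_real l) \<noteq> 0"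
    by (auto simp: eventually_at_top_linorder)
  define R where "R = max \<bar>L\<bar> C"
  \<comment> \<open>A constant would have to be 0 by the limit at infinity, against the lower bound
    at - C.\<close>
  have nc: "\<not> charfun constant_on UNIV"
  proof
    assume "charfun constant_on UNIV"
    then obtain k where k: "\<And>z. charfun z = k" by (auto simp: constant_on_def)
    have "k = 0" using charfun_tendsto_0 unfolding k by (simp add: tendsto_const_iff)
    with Re_charfun_ge_1[of "- C"] k show False by simp
  qed
  have "finite {\<mu> \<in> cball 0 R. charfun \<mu> = 0}"
    by (rule holomorphic_compact_finite_zeros[OF holomorphic_charfun _ _ _ _ nc]) auto
  moreover have "{\<mu>. charfun \<mu> = 0 \<and> \<mu> \<in> \<real>} \<subseteq> {\<mu> \<in> cball 0 R. charfun \<mu> = 0}"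
  proof (safe elim!: Reals_cases)
    fix r :: real assume z: "charfun (of_real r) = 0"
    then have "r < L" "- C < r" using L[of r] Re_charfun_ge_1[of r] by (auto simp: not_le[symmetric])
    then have "\<bar>r\<bar> \<le> R" unfolding R_def by linarith
    then show "complex_of_real r \<in> cball 0 R" by simp
  qed
  ultimately show ?thesis by (rule rev_finite_subset)
qed

lemma infinite_nonreal_zeros: "infinite {\<mu>. charfun \<mu> = 0 \<and> \<mu> \<notin> \<real>}"
proof
  assume "finite {\<mu>. charfun \<mu> = 0 \<and> \<mu> \<notin> \<real>}"
  with finite_real_zeros have "finite ({\<mu>. charfun \<mu> = 0 \<and> \<mu> \<in> \<real>} \<union> {\<mu>. charfun \<mu> = 0 \<and> \<mu> \<notin> \<real>})" by simp
  also have "{\<mu>. charfun \<mu> = 0 \<and> \<mu> \<in> \<real>} \<union> {\<mu>. charfun \<mu> = 0 \<and> \<mu> \<notin> \<real>} = {\<mu>. charfun \<mu> = 0}" by auto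
  finally have fin: "finite {\<mu>. charfun \<mu> = 0}" .
  obtain d R where d: "d > 0" "\<And>z. norm z \<ge> R \<Longrightarrow> norm (charfun z) \<ge> d"
    using entire_finite_zeros_bounded_below[OF holomorphic_charfun fin _ _ C_nonneg _ charfun_growth] alpha by auto
  have "\<forall>\<^sub>F l::real in at_top. dist (charfun (of_real l)) 0 < d"
    using charfun_tendsto_0 d(1) by (rule tendstoD)
  then have "\<forall>\<^sub>F l::real in at_top. False"
    using eventually_ge_at_top[of "\<bar>R\<bar>"]
  proof eventually_elim
    case (elim l)
    then have "R \<le> norm (complex_of_real l)" unfolding norm_of_real by linarith
    from d(2)[OF this] elim show ?case by simp
  qed
  then show False by simp
qed

end

section \<open>Eigenvalues as zeros of the characteristic function\<close>

text \<open>Agreement almost everywhere on (0, 1] is enough. This covers both the change of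
  representative of the potential and the cutoff of the solution at 0.\<close>

lemma rl_integral_eq_frac_int:
  assumes f: "f \<in> borel_measurable (lebesgue_on {0..1})" and g[measurable]: "g \<in> borel_measurable borel"
    and ae: "AE s in lebesgue. s \<in> {0<..1} \<longrightarrow> f s = g s" and g0: "\<And>s. s \<le> 0 \<Longrightarrow> g s = 0"
    and t: "t \<in> {0..1}" and b: "\<beta> > 0"
  shows "rl_integral \<beta> f t = frac_int \<beta> g t"
proof -
  have G: "Gamma \<beta> > 0" using b by simp
  let ?h1 = "\<lambda>s. indicator {0..t} s *\<^sub>R ((t - s) powr (\<beta> - 1) *\<^sub>R f s)"
  let ?h2 = "\<lambda>s. Gamma \<beta> *\<^sub>R (rl_kernel \<beta> (t - s) *\<^sub>R g s)"
  have h2: "?h2 \<in> borel_measurable lborel" by measurable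
  have "(\<lambda>s. if s \<in> {0..1} then f s else 0) \<in> borel_measurable lebesgue"
    using f by (subst borel_measurable_if) auto
  moreover have "(\<lambda>s. indicator {0..t} s * (t - s) powr (\<beta> - 1)) \<in> borel_measurable lebesgue"
    by (rule measurable_completion) measurable
  ultimately have "(\<lambda>s. (indicator {0..t} s * (t - s) powr (\<beta> - 1)) *\<^sub>R (if s \<in> {0..1} then f s else 0)) \<in> borel_measurable lebesgue"
    by (intro borel_measurable_scaleR)
  also have "(\<lambda>s. (indicator {0..t} s * (t - s) powr (\<beta> - 1)) *\<^sub>R (if s \<in> {0..1} then f s else 0)) = ?h1"
    using t by (auto simp: fun_eq_iff indicator_def)
  finally have h1: "?h1 \<in> borel_measurable lebesgue" .
  have "AE s in lebesgue. s \<noteq> 0" "AE s in lebesgue. s \<noteq> t"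
    by (intro AE_completion AE_lborel_singleton)+
  with ae have "AE s in lebesgue. ?h1 s = ?h2 s"
  proof eventually_elim
    case (elim s)
    consider "s < 0" | "0 < s" "s < t" | "t < s" using elim by linarith
    then show ?case using elim t g0 G by cases (auto simp: rl_kernel_def)
  qed
  then have "integral\<^sup>L lebesgue ?h1 = integral\<^sup>L lebesgue ?h2"
    by (intro integral_cong_AE h1 measurable_completion h2)
  also have "\<dots> = integral\<^sup>L lborel ?h2"
    by (rule integral_completion[OF h2])
  also have "\<dots> = Gamma \<beta> *\<^sub>R frac_int \<beta> g t"
    unfolding frac_int_def by (rule integral_scaleR_right)
  finally show ?thesis
    using G unfolding rl_integral_def set_lebesgue_integral_def by simp
qed

lemma frac_int_nonpos:
  assumes "\<And>s. s \<le> 0 \<Longrightarrow> f s = 0" "t \<le> 0"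
  shows "frac_int \<beta> f t = 0"
  using frac_int_cong[of t f "\<lambda>_. 0" \<beta>] assms by simp

text \<open>Truncating a Borel version of q at the essential bound makes the bound hold everywhere
  and changes values only on a null set.\<close>

lemma L_infinity_01_borel_representative:
  assumes "L_infinity_01 q"
  obtains q' C where "q' \<in> borel_measurable borel" "\<And>x. \<bar>q' x\<bar> \<le> C" "AE x in lebesgue. x \<in> {0..1} \<longrightarrow> q x = q' x"
proof -
  from assms obtain C0 where q: "q \<in> borel_measurable (lebesgue_on {0..1})" and C0: "AE x in lebesgue_on {0..1}. \<bar>q x\<bar> \<le> C0"
    by (auto simp: L_infinity_01_def)
  have "(\<lambda>x. if x \<in> {0..1} then q x else 0) \<in> borel_measurable lebesgue"
    using q by (subst borel_measurable_if) auto
  from completion_ex_borel_measurable_real[OF this] obtain g where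
    g: "g \<in> borel_measurable lborel" "AE x in lborel. (if x \<in> {0..1} then q x else 0) = g x" by blast
  define C where "C = \<bar>C0\<bar>"
  define q' where "q' x = max (- C) (min C (g x))" for x
  show thesis
  proof (rule that)
    show "q' \<in> borel_measurable borel" using g(1) unfolding q'_def by measurable
    show "\<bar>q' x\<bar> \<le> C" for x by (auto simp: q'_def C_def)
    have "AE x in lebesgue. x \<in> {0..1} \<longrightarrow> \<bar>q x\<bar> \<le> C0"
      using C0 by (subst (asm) AE_restrict_space_iff) auto
    with AE_completion[OF g(2)] show "AE x in lebesgue. x \<in> {0..1} \<longrightarrow> q x = q' x"
      by eventually_elim (auto simp: q'_def C_def)
  qed
qed

text \<open>By uniqueness every continuous solution is c times \<open>solution \<mu>\<close> on (0,
  1]. Nontriviality forces c to be nonzero, and the condition at 1 reads c * charfun \<mu> =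
  0.\<close>

lemma (in fractional_problem) is_eigenvalue_iff:
  fixes q0 :: "real \<Rightarrow> real"
  assumes q0: "q0 \<in> borel_measurable (lebesgue_on {0..1})" and ae: "AE x in lebesgue. x \<in> {0..1} \<longrightarrow> q0 x = q x"
  shows "is_eigenvalue \<alpha> q0 \<mu> \<longleftrightarrow> charfun \<mu> = 0"
proof -
  have a: "2 * \<alpha> > 0" "1 - \<alpha> > 0" using alpha by auto
  note q0[measurable]
  have cont_meas: "f \<in> borel_measurable (lebesgue_on {0..1})" if "continuous_on {0..1} f" for f :: "real \<Rightarrow> complex"
    using that by (rule continuous_imp_measurable_on_sets_lebesgue) auto
  have potential: "rl_integral (2 * \<alpha>) (\<lambda>s. (of_real (q0 s) - \<mu>) * y s) t = frac_int (2 * \<alpha>) (\<lambda>s. (of_real (q s) - \<mu>) * z s) t"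
    if y: "continuous_on {0..1} y" and z: "admissible z" "\<And>s. s \<in> {0<..1} \<Longrightarrow> y s = z s" and t: "t \<in> {0..1}" for y z t
  proof (rule rl_integral_eq_frac_int[OF _ _ _ _ t a(1)])
    note cont_meas[OF y, measurable]
    show "(\<lambda>s. (of_real (q0 s) - \<mu>) * y s) \<in> borel_measurable (lebesgue_on {0..1})" by measurable
    show "(\<lambda>s. (of_real (q s) - \<mu>) * z s) \<in> borel_measurable borel"
      by (intro admissible_measurable admissible_potential z)
    show "AE s in lebesgue. s \<in> {0<..1} \<longrightarrow> (of_real (q0 s) - \<mu>) * y s = (of_real (q s) - \<mu>) * z s"
      using ae by eventually_elim (use z in auto)
  qed (use admissible_eq_0[OF z(1)] in simp)
  have boundary: "rl_integral (1 - \<alpha>) y 1 = frac_int (1 - \<alpha>) z 1"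
    if y: "continuous_on {0..1} y" and z: "admissible z" "\<And>s. s \<in> {0<..1} \<Longrightarrow> y s = z s" for y z
    by (rule rl_integral_eq_frac_int[OF cont_meas[OF y] admissible_measurable[OF z(1)] _ admissible_eq_0[OF z(1)] _ a(2)])
      (use z(2) in auto)
  have kernel: "t powr \<alpha> / Gamma (\<alpha> + 1) = rl_kernel (\<alpha> + 1) t" if "t \<ge> 0" for t
    using that by (auto simp: rl_kernel_def)
  show ?thesis
  proof
    assume "is_eigenvalue \<alpha> q0 \<mu>"
    then obtain y c t0 where y: "continuous_on {0..1} y"
      "\<And>t. t \<in> {0..1} \<Longrightarrow> y t = c * of_real (t powr \<alpha> / Gamma (\<alpha> + 1)) + rl_integral (2 * \<alpha>) (\<lambda>s. (of_real (q0 s) - \<mu>) * y s) t"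
      and t0: "t0 \<in> {0..1}" "y t0 \<noteq> 0" and y1: "rl_integral (1 - \<alpha>) y 1 = 0"
      unfolding is_eigenvalue_def is_solution_def by blast
    \<comment> \<open>Only the values of y on [0, 1] are constrained, so y is replaced by 0
      elsewhere. The point 0 is dropped too, as admissible functions vanish there.\<close>
    define z where "z s = (if s \<in> {0<..1} then y s else 0)" for s
    have z: "admissible z"
    proof -
      have "bounded (y ` {0..1})"
        by (intro compact_imp_bounded compact_continuous_image y(1)) auto
      then obtain B where B: "\<And>s. s \<in> {0..1} \<Longrightarrow> norm (y s) \<le> B" unfolding bounded_iff by blast
      have "(\<lambda>s. indicator {0..1} s *\<^sub>R y s) \<in> borel_measurable borel"
        using y(1) by (intro borel_measurable_continuous_on_indicator) auto
      then have "(\<lambda>s. indicator {0<..1::real} s *\<^sub>R (indicator {0..1} s *\<^sub>R y s)) \<in> borel_measurable borel" by measurable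
      also have "(\<lambda>s. indicator {0<..1::real} s *\<^sub>R (indicator {0..1} s *\<^sub>R y s)) = z" by (auto simp: fun_eq_iff z_def)
      finally show ?thesis
        by (rule admissible_of_bound[where c = 1 and A = B]) (use B in \<open>auto simp: z_def rl_kernel_one\<close>)
    qed
    have zy: "y s = z s" if "s \<in> {0<..1}" for s using that by (simp add: z_def)
    have zeq: "z t = c * of_real (rl_kernel (\<alpha> + 1) t) + frac_int (2 * \<alpha>) (\<lambda>s. (of_real (q s) - \<mu>) * z s) t" if "t \<le> 1" for t
    proof (cases "t > 0")
      case True
      then show ?thesis using y(2)[of t] potential[OF y(1) z zy, of t] that kernel[of t] by (simp add: z_def)
    next
      case False
      then show ?thesis using admissible_eq_0[OF z] by (simp add: frac_int_nonpos)
    qed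
    have eq: "z t = c * solution \<mu> t" if "t \<le> 1" for t
    proof -
      let ?d = "\<lambda>t. z t + - (c * solution \<mu> t)"
      have "?d t = 0"
      proof (rule homogeneous_equation_trivial[OF _ _ that])
        show "admissible ?d" by (intro admissible_add admissible_uminus admissible_cmult z admissible_solution)
        fix t :: real assume t: "t \<le> 1"
        have "(\<lambda>s. (of_real (q s) - \<mu>) * ?d s)
            = (\<lambda>s. (of_real (q s) - \<mu>) * z s + - (c * ((of_real (q s) - \<mu>) * solution \<mu> s)))"
          by (simp add: fun_eq_iff algebra_simps)
        then have "frac_int (2 * \<alpha>) (\<lambda>s. (of_real (q s) - \<mu>) * ?d s) t
            = frac_int (2 * \<alpha>) (\<lambda>s. (of_real (q s) - \<mu>) * z s) t + - (c * frac_int (2 * \<alpha>) (\<lambda>s. (of_real (q s) - \<mu>) * solution \<mu> s) t)"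
          using t a by (simp only:) (subst frac_int_add; auto simp: frac_int_uminus frac_int_cmult
              intro!: admissible_uminus admissible_cmult admissible_potential admissible_solution z)
        then show "?d t = frac_int (2 * \<alpha>) (\<lambda>s. (of_real (q s) - \<mu>) * ?d s) t"
          using zeq[OF t] solution_eq[OF t, of \<mu>] by (simp add: algebra_simps)
      qed
      then show ?thesis by simp
    qed
    \<comment> \<open>From 0 powr \<alpha> = 0 and the vanishing of the integral at 0. Hence the
      point where y does not vanish lies in (0, 1], where y and z agree.\<close>
    have "y 0 = 0"
      using y(2)[of 0] potential[OF y(1) z zy, of 0] admissible_eq_0[OF z] by (simp add: frac_int_nonpos)
    with t0 have "t0 \<in> {0<..1}" by (cases "t0 = 0") auto
    then have "c \<noteq> 0" using zy[of t0] eq[of t0] t0(2) by auto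
    moreover have "frac_int (1 - \<alpha>) z 1 = c * charfun \<mu>"
      unfolding charfun_def frac_int_cmult[symmetric] by (rule frac_int_cong) (simp add: eq)
    ultimately show "charfun \<mu> = 0" using boundary[OF y(1) z zy] y1 by simp
  next
    assume F: "charfun \<mu> = 0"
    let ?y = "solution \<mu>"
    let ?g = "\<lambda>t. of_real (rl_kernel (\<alpha> + 1) t) + frac_int (2 * \<alpha>) (\<lambda>s. (of_real (q s) - \<mu>) * ?y s) t"
    have "continuous_on {0..1} ?g"
      using alpha
      by (intro continuous_intros continuous_on_subset[OF continuous_on_rl_kernel]
          continuous_on_subset[OF continuous_on_frac_int[OF admissible_potential[OF admissible_solution]]]) auto
    then have cont: "continuous_on {0..1} ?y"
      by (rule continuous_on_eq) (use solution_eq[of _ \<mu>] in auto)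
    have "is_solution \<alpha> q0 \<mu> ?y"
      unfolding is_solution_def
    proof (intro conjI cont exI[of _ 1] ballI)
      fix t :: real assume "t \<in> {0..1}"
      then show "?y t = 1 * of_real (t powr \<alpha> / Gamma (\<alpha> + 1)) + rl_integral (2 * \<alpha>) (\<lambda>s. (of_real (q0 s) - \<mu>) * ?y s) t"
        using solution_eq[of t \<mu>] potential[OF cont admissible_solution refl, of t] kernel[of t] by simp
    qed
    \<comment> \<open>If the solution vanished, the integral equation at t = 1 would reduce to 0 = 1
      / Gamma (\<alpha> + 1).\<close>
    moreover have "\<exists>t\<in>{0..1}. ?y t \<noteq> 0"
    proof (rule ccontr)
      assume "\<not> ?thesis"
      then have 0: "?y t = 0" if "t \<le> 1" for t
        using that admissible_eq_0[OF admissible_solution, of t] by (cases "t \<ge> 0") auto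
      then have "frac_int (2 * \<alpha>) (\<lambda>s. (of_real (q s) - \<mu>) * ?y s) 1 = frac_int (2 * \<alpha>) (\<lambda>_. 0) 1"
        by (intro frac_int_cong) simp
      then have "rGamma (\<alpha> + 1) = 0" using solution_eq[of 1 \<mu>] 0[of 1] by (simp add: rl_kernel_one_right)
      moreover have "Gamma (\<alpha> + 1) > 0" using alpha by (intro Gamma_real_pos) auto
      ultimately show False by (simp add: rGamma_inverse_Gamma)
    qed
    moreover have "rl_integral (1 - \<alpha>) ?y 1 = 0"
      using boundary[OF cont admissible_solution refl] F by (simp add: charfun_def)
    ultimately show "is_eigenvalue \<alpha> q0 \<mu>" unfolding is_eigenvalue_def by blast
  qed
qed

theorem mainTheorem1:
  fixes \<alpha> :: real and q :: "real \<Rightarrow> real"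
  assumes "1 / 2 < \<alpha>" and "\<alpha> < 1"
    and "L_infinity_01 q"
  shows "finite {\<mu>::complex. is_eigenvalue \<alpha> q \<mu> \<and> \<mu> \<in> \<real>} \<and>
         infinite {\<mu>::complex. is_eigenvalue \<alpha> q \<mu> \<and> \<mu> \<notin> \<real>}"
proof -
  obtain q' C where q': "q' \<in> borel_measurable borel" "\<And>x. \<bar>q' x\<bar> \<le> C"
      "AE x in lebesgue. x \<in> {0..1} \<longrightarrow> q x = q' x"
    by (rule L_infinity_01_borel_representative[OF assms(3)]) (rule that)
  interpret fractional_problem \<alpha> C q'
    by unfold_locales (use assms q' in auto)
  have "q \<in> borel_measurable (lebesgue_on {0..1})" using assms(3) by (simp add: L_infinity_01_def)
  note iff = is_eigenvalue_iff[OF this q'(3)]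
  show ?thesis unfolding iff using finite_real_zeros infinite_nonreal_zeros by simp
qed

end
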